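(* For real fields $\epsilon_+^l,\epsilon_-^l,\epsilon_k^l$, $l=0,\dots,L$, with $\epsilon_+^{-1}=\epsilon_+^L$, let $$U=\frac12\sum_{l=0}^L\Big((1+\sigma_w^4/2)(\epsilon_+^l)^2+(\epsilon_-^l)^2+3(\epsilon_k^l)^2+\epsilon_k^l(\epsilon_+^l-\epsilon_-^l)-\sigma_w^2\epsilon_+^{l-1}(\epsilon_+^l+\epsilon_-^l)\Big),\qquad 0<\sigma_w^2<2.$$ Changing variables to the Fourier basis, $\epsilon_x^l=(L+1)^{-1/2}\sum_qe^{-iql}\epsilon_x^q$ for $x\in\{+,-,k\}$, with $q$ running over $2\pi n/(L+1)$, $n=0,\dots,L$, yields the distribution over Fourier modes defined by the energy $$U=\frac12\sum_q\begin{pmatrix}\epsilon_+^{-q}&\epsilon_-^{-q}&\epsilon_k^{-q}\end{pmatrix}\begin{pmatrix}1+\sigma_w^4/2-\sigma_w^2\cos q&-\frac12\sigma_w^2e^{-iq}&\frac12\\-\frac12\sigma_w^2e^{iq}&1&-\frac12\\\frac12&-\frac12&3\end{pmatrix}\begin{pmatrix}\epsilon_+^q\\ \epsilon_-^q\\ \epsilon_k^q\end{pmatrix},$$ which is well defined as a Gaussian with inverse covariance matrix $$\Sigma^{-1}(q)=\begin{pmatrix}1+\sigma_w^4/2-\sigma_w^2\cos q&-\frac12\sigma_w^2e^{-iq}&\frac12\\-\frac12\sigma_w^2e^{iq}&1&-\frac12\\\frac12&-\frac12&3\end{pmatrix}.$$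
   Context: Superscripts $l$ are layer indices and superscripts $q$ are wavevector labels, not powers; $\sigma_w^4=(\sigma_w^2)^2$. Since the fields are real, $\epsilon_x^{-q}=\overline{\epsilon_x^q}$, with $-q$ taken modulo $2\pi$. The distribution defined by an energy $U$ is the one with density proportional to $e^{-U}$. $U$ is the quadratic-order energy given for (rescaled) small fluctuations, about the uniform saddle point configuration, of the norm of the positive components ($\epsilon_+$), the norm of the negative components ($\epsilon_-$), and the component count ($\epsilon_k$) of the pre-activations in the rectified linear stochastic network on a ring, with weight variance parameter $\sigma_w^2$. *)

theory Defs
  imports "HOL-Probability.Probability"
begin

text \<open>
  The ring has the sites (layers) \<open>0, \<dots>, L\<close>. The components \<open>1, 2, 3\<close> of a vector
  are the components \<open>+, -, k\<close> of the fluctuation fields. Configurations are functions of the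
  layer (or of the number \<open>n\<close> of the wavevector \<open>2 \<pi> n / (L + 1)\<close>), taken
  \<open>undefined\<close> outside \<open>{..L}\<close> wherever they are points of a product measure space.
\<close>

definition prev :: "nat \<Rightarrow> nat \<Rightarrow> nat" where
  "prev L l = (if l = 0 then L else l - 1)"

definition energy :: "real \<Rightarrow> nat \<Rightarrow> (nat \<Rightarrow> real^3) \<Rightarrow> real" where
  "energy \<sigma> L x = 1/2 * (\<Sum>l\<le>L.
     (1 + \<sigma>^4 / 2) * (x l $ 1)\<^sup>2 + (x l $ 2)\<^sup>2 + 3 * (x l $ 3)\<^sup>2
     + x l $ 3 * (x l $ 1 - x l $ 2)
     - \<sigma>\<^sup>2 * x (prev L l) $ 1 * (x l $ 1 + x l $ 2))"

definition wavevector :: "nat \<Rightarrow> nat \<Rightarrow> real" where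
  "wavevector L n = 2 * pi * real n / real (L + 1)"

text \<open>The number of the wavevector \<open>-q\<close> modulo \<open>2 \<pi>\<close>.\<close>

definition neg_mode :: "nat \<Rightarrow> nat \<Rightarrow> nat" where
  "neg_mode L n = (L + 1 - n) mod (L + 1)"

definition fourier_modes :: "nat \<Rightarrow> (nat \<Rightarrow> real^3) \<Rightarrow> (nat \<Rightarrow> complex^3) \<Rightarrow> bool" where
  "fourier_modes L x z \<longleftrightarrow> (\<forall>l\<le>L. \<forall>a.
     complex_of_real (x l $ a) =
       complex_of_real (1 / sqrt (real (L + 1))) *
       (\<Sum>n\<le>L. exp (- \<i> * complex_of_real (wavevector L n) * of_nat l) * z n $ a))"

definition to_modes :: "nat \<Rightarrow> (nat \<Rightarrow> real^3) \<Rightarrow> (nat \<Rightarrow> complex^3)" where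
  "to_modes L x = (THE z. z \<in> extensional {..L} \<and> fourier_modes L x z)"

definition real_modes :: "nat \<Rightarrow> (nat \<Rightarrow> complex^3) set" where
  "real_modes L = {z \<in> extensional {..L}. \<forall>n\<le>L. \<forall>a. z (neg_mode L n) $ a = cnj (z n $ a)}"

definition Sigma_inv :: "real \<Rightarrow> real \<Rightarrow> complex^3^3" where
  "Sigma_inv \<sigma> q = vector
    [vector [complex_of_real (1 + \<sigma>^4 / 2 - \<sigma>\<^sup>2 * cos q),
             - (1/2) * complex_of_real (\<sigma>\<^sup>2) * exp (- \<i> * complex_of_real q), 1/2],
     vector [- (1/2) * complex_of_real (\<sigma>\<^sup>2) * exp (\<i> * complex_of_real q), 1, - (1/2)],
     vector [1/2, - (1/2), 3]]"

definition mode_energy :: "real \<Rightarrow> nat \<Rightarrow> (nat \<Rightarrow> complex^3) \<Rightarrow> complex" where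
  "mode_energy \<sigma> L z = 1/2 * (\<Sum>n\<le>L. \<Sum>a\<in>UNIV.
     z (neg_mode L n) $ a * (Sigma_inv \<sigma> (wavevector L n) *v z n) $ a)"

definition pos_def_hermitian :: "complex^'n^'n \<Rightarrow> bool" where
  "pos_def_hermitian A \<longleftrightarrow>
     (\<forall>a b. A $ b $ a = cnj (A $ a $ b)) \<and>
     (\<forall>v. v \<noteq> 0 \<longrightarrow> 0 < Re (\<Sum>a\<in>UNIV. cnj (v $ a) * (A *v v) $ a))"

text \<open>
  The distribution with density proportional to \<open>exp (- E)\<close> with respect to \<open>M\<close>;
  a probability measure exactly when the normalisation is neither zero nor infinite.
\<close>

definition boltzmann :: "'a measure \<Rightarrow> ('a \<Rightarrow> real) \<Rightarrow> 'a measure" where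
  "boltzmann M E =
     density M (\<lambda>x. ennreal (exp (- E x)) / (\<integral>\<^sup>+ y. ennreal (exp (- E y)) \<partial>M))"

definition field_lebesgue :: "nat \<Rightarrow> (nat \<Rightarrow> real^3) measure" where
  "field_lebesgue L = (\<Pi>\<^sub>M l\<in>{..L}. lborel)"

definition mode_space :: "nat \<Rightarrow> (nat \<Rightarrow> complex^3) measure" where
  "mode_space L = (\<Pi>\<^sub>M n\<in>{..L}. borel)"

text \<open>
  The modes of real fields are not independent complex variables. Independent real coordinates
  are the real and imaginary parts of one mode from each pair \<open>{q, -q}\<close> with \<open>q \<noteq> -q\<close>,
  and the value of each self-conjugate mode (\<open>q = 0\<close>, and \<open>q = \<pi>\<close> when \<open>L\<close> is odd).
  Lebesgue measure in these coordinates is the reference measure for densities over modes.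
\<close>

definition modes_of_coords :: "nat \<Rightarrow> (nat \<Rightarrow> real^3) \<Rightarrow> (nat \<Rightarrow> complex^3)" where
  "modes_of_coords L c = (\<lambda>n\<in>{..L}. \<chi> a.
     if neg_mode L n = n then complex_of_real (c n $ a)
     else if n < neg_mode L n then Complex (c n $ a) (c (neg_mode L n) $ a)
     else Complex (c (neg_mode L n) $ a) (- (c n $ a)))"

definition mode_lebesgue :: "nat \<Rightarrow> (nat \<Rightarrow> complex^3) measure" where
  "mode_lebesgue L = distr (\<Pi>\<^sub>M n\<in>{..L}. lborel) (mode_space L) (modes_of_coords L)"

lemma neg_mode_le: "neg_mode L n \<le> L"
  unfolding neg_mode_def by (metis Suc_eq_plus1 less_Suc_eq_le mod_less_divisor zero_less_Suc)

lemma neg_mode_neg_mode: "n \<le> L \<Longrightarrow> neg_mode L (neg_mode L n) = n"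
  by (cases "n = 0") (auto simp: neg_mode_def)

lemma bij_betw_modes_of_coords:
  "bij_betw (modes_of_coords L) (extensional {..L}) (real_modes L)"
proof (rule bij_betw_byWitness[where f' = "\<lambda>z. \<lambda>n\<in>{..L}. \<chi> a.
    if n \<le> neg_mode L n then Re (z n $ a) else - Im (z n $ a)"])
  show "\<forall>c\<in>extensional {..L}. (\<lambda>n\<in>{..L}. \<chi> a.
      if n \<le> neg_mode L n then Re (modes_of_coords L c n $ a)
      else - Im (modes_of_coords L c n $ a)) = c"
    by (auto simp: modes_of_coords_def fun_eq_iff vec_eq_iff extensional_def)
next
  show "\<forall>z\<in>real_modes L. modes_of_coords L (\<lambda>n\<in>{..L}. \<chi> a.
      if n \<le> neg_mode L n then Re (z n $ a) else - Im (z n $ a)) = z"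
  proof
    fix z assume z: "z \<in> real_modes L"
    have ext: "z n = undefined" if "\<not> n \<le> L" for n
      using z that by (auto simp: real_modes_def extensional_def)
    have cj: "z (neg_mode L n) $ a = cnj (z n $ a)" if "n \<le> L" for n a
      using z that by (auto simp: real_modes_def)
    have "modes_of_coords L (\<lambda>n\<in>{..L}. \<chi> a.
        if n \<le> neg_mode L n then Re (z n $ a) else - Im (z n $ a)) n = z n" for n
    proof (cases "n \<le> L")
      case True
      have fix_real: "Im (z n $ a) = 0" if "neg_mode L n = n" for a
        using cj[OF True, of a] that by (simp add: complex_eq_iff)
      show ?thesis
        using True cj[OF True] fix_real
        by (auto simp: modes_of_coords_def vec_eq_iff complex_eq_iff neg_mode_le neg_mode_neg_mode)
    qed (simp add: modes_of_coords_def ext)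
    then show "modes_of_coords L (\<lambda>n\<in>{..L}. \<chi> a.
        if n \<le> neg_mode L n then Re (z n $ a) else - Im (z n $ a)) = z" by blast
  qed
next
  show "modes_of_coords L ` extensional {..L} \<subseteq> real_modes L"
    by (auto simp: modes_of_coords_def real_modes_def vec_eq_iff complex_eq_iff
        neg_mode_le neg_mode_neg_mode)
next
  show "(\<lambda>z. \<lambda>n\<in>{..L}. \<chi> a. if n \<le> neg_mode L n then Re (z n $ a) else - Im (z n $ a))
      ` real_modes L \<subseteq> extensional {..L}"
    by auto
qed

definition mode_mean :: "(nat \<Rightarrow> complex^3) measure \<Rightarrow> nat \<Rightarrow> complex^3" where
  "mode_mean P n = (\<chi> a. \<integral>z. z n $ a \<partial>P)"

definition mode_cov :: "(nat \<Rightarrow> complex^3) measure \<Rightarrow> nat \<Rightarrow> nat \<Rightarrow> complex^3^3" where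
  "mode_cov P n m = (\<chi> a b.
     \<integral>z. (z n $ a - mode_mean P n $ a) * cnj (z m $ b - mode_mean P m $ b) \<partial>P)"

end

theory Submission
  imports Defs "HOL-Real_Asymp.Real_Asymp"
begin

text \<open>
  The discrete Fourier transform turns shifts of the ring into multiplication by phases, so that it
  turns the gradient \<open>\<nabla>U\<close> of the energy into \<open>\<Sigma>\<^sup>-\<^sup>1(q) \<epsilon>\<^sup>q\<close>;
  Parseval's identity for \<open>U = \<langle>\<epsilon>, \<nabla>U\<rangle>/2\<close> gives the energy of the modes. Completing squares
  shows that the energy is coercive for \<open>0 < \<sigma>\<^sup>2 < 2\<close>.

  No determinant and no Gaussian integral is computed. A surjective additive measurable map rescales
  Lebesgue measure by a constant, which the normalisation absorbs. Translation invariance gives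
  \<open>E exp (t \<langle>v, \<nabla>U\<rangle>) = exp (t\<^sup>2 U(v))\<close>, hence the covariance of the components of \<open>\<nabla>U\<close>
  is the Hessian of \<open>U\<close>. After the Fourier transform, \<open>\<Sigma>\<^sup>-\<^sup>1(q) \<epsilon>\<^sup>q\<close> has
  covariance \<open>\<Sigma>\<^sup>-\<^sup>1(q)\<close> and different modes are uncorrelated.
\<close>

section \<open>Lebesgue measure on finite products\<close>

text \<open>The modes of a real field satisfy eps(-q) = conj eps(q), so densities over modes refer
  to the image of Lebesgue measure in half as many coordinates. For L \<ge> 2 the map from fields to
  these coordinates is no isometry, because Parseval's identity counts each pair {q, -q} with q
  \<noteq> -q twice; its constant factor is therefore not 1.

  The gradient is preferred to the field because a translation by v produces <v, grad U> directly,
  with no inverse Hessian inside an integral. Inversion happens only at the end: with V the inverse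
  of \<open>Sigma_inv\<close>, the covariance of the modes is V Sigma_inv V^H = V, where ^H is the
  conjugate transpose.

  The threshold 2 is the critical point of the mode q = 0. With s = sigma^2, minimising over eps_-
  and eps_k leaves 10/11 + 5/22 s^2 - 10/11 s cos q as coefficient of |eps_+|^2, which at q = 0 is
  10/11 (1 - s/2)^2. The contribution of one site to U is not bounded below by its own squares,
  since the previous layer enters negatively; only the sum around the ring is, hence the telescoping
  term in \<open>site_energy_ge\<close>.\<close>

lemma distr_lborel_shift: "distr lborel borel (\<lambda>x. x + v) = (lborel :: 'a::euclidean_space measure)"
  using lborel_affine[of 1 v] by (simp add: density_1 add.commute)

lemma distr_lborel_reflect: "distr lborel borel (\<lambda>x. v - x) = (lborel :: 'a::euclidean_space measure)"
  using lborel_affine[of "-1" v] by (simp add: density_1)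

interpretation lborel_prod: product_sigma_finite "\<lambda>_::'i. lborel :: 'a::euclidean_space measure"
  by standard

text \<open>The image of the product measure agrees with it on boxes, which determine it. This
  covers translations and reflections of configurations at once; \<open>restrict\<close> keeps the
  image points extensional.\<close>

lemma nn_integral_PiM_lborel_comp:
  fixes f :: "'i \<Rightarrow> 'a::euclidean_space \<Rightarrow> 'a"
  assumes I: "finite I"
    and f: "\<And>i. f i \<in> borel_measurable borel" "\<And>i. distr lborel borel (f i) = lborel"
    and h: "h \<in> borel_measurable (PiM I (\<lambda>_. lborel))"
  shows "(\<integral>\<^sup>+x. h (\<lambda>i\<in>I. f i (x i)) \<partial>PiM I (\<lambda>_. lborel)) = (\<integral>\<^sup>+x. h x \<partial>PiM I (\<lambda>_. lborel))"
proof -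
  let ?M = "PiM I (\<lambda>_. lborel :: 'a measure)" and ?F = "\<lambda>x. \<lambda>i\<in>I. f i (x i)"
  have [measurable]: "f i \<in> measurable lborel lborel" for i
    using f(1) by simp
  have F[measurable]: "?F \<in> measurable ?M ?M"
    by (rule measurable_restrict) measurable
  have "distr ?M ?M ?F = ?M"
  proof (rule lborel_prod.PiM_eqI[OF I])
    fix A :: "'i \<Rightarrow> 'a set" assume A: "\<And>i. i \<in> I \<Longrightarrow> A i \<in> sets lborel"
    have "?F -` Pi\<^sub>E I A \<inter> space ?M = Pi\<^sub>E I (\<lambda>i. f i -` A i)"
      by (auto simp: space_PiM PiE_iff)
    moreover have "f i -` A i \<in> sets lborel" if "i \<in> I" for i
      using measurable_sets[OF f(1)[of i], of "A i"] A[OF that] by simp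
    moreover have "emeasure lborel (f i -` A i) = emeasure lborel (A i)" if "i \<in> I" for i
      using emeasure_distr[of "f i" lborel borel "A i"] f A[OF that] by simp
    ultimately show "emeasure (distr ?M ?M ?F) (Pi\<^sub>E I A) = (\<Prod>i\<in>I. emeasure lborel (A i))"
      using A I by (simp add: emeasure_distr sets_PiM_I_finite lborel_prod.emeasure_PiM)
  qed simp
  then show ?thesis
    using nn_integral_distr[OF F, of h] h by simp
qed

lemma emeasure_PiM_lborel_space:
  "finite I \<Longrightarrow> emeasure (PiM I (\<lambda>_. lborel :: 'a::euclidean_space measure)) (space (PiM I (\<lambda>_. lborel))) \<noteq> 0"
  by (simp add: space_PiM lborel_prod.emeasure_PiM emeasure_lborel_UNIV)

text \<open>Uniqueness of Haar measure for the image of Lebesgue measure under \<open>T\<close>: in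
  \<open>\<integral>\<integral> f (T x) g (y) dy dx\<close> shift \<open>y\<close> by \<open>T x\<close>, and then \<open>x\<close> by a preimage of \<open>-y\<close>.\<close>

lemma nn_integral_PiM_lborel_additive:
  fixes T :: "('i \<Rightarrow> 'a::euclidean_space) \<Rightarrow> ('i \<Rightarrow> 'a)"
  defines "M i \<equiv> PiM i (\<lambda>_. lborel :: 'a measure)"
  assumes I: "finite I"
    and T[measurable]: "T \<in> measurable (M I) (M I)"
    and add: "\<And>x y. x \<in> space (M I) \<Longrightarrow> y \<in> space (M I) \<Longrightarrow>
      T (\<lambda>i\<in>I. x i + y i) = (\<lambda>i\<in>I. T x i + T y i)"
    and surj: "\<And>y. y \<in> space (M I) \<Longrightarrow> \<exists>x\<in>space (M I). T x = y"
    and f[measurable]: "f \<in> borel_measurable (M I)"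
    and g[measurable]: "g \<in> borel_measurable (M I)"
  shows "(\<integral>\<^sup>+x. f (T x) \<partial>M I) * (\<integral>\<^sup>+x. g x \<partial>M I) = (\<integral>\<^sup>+x. g (T x) \<partial>M I) * (\<integral>\<^sup>+x. f x \<partial>M I)"
proof -
  interpret sigma_finite_measure "M I"
    unfolding M_def by (rule lborel_prod.sigma_finite[OF I])
  interpret P: pair_sigma_finite "M I" "M I" ..
  have sp: "x \<in> space (M I) \<longleftrightarrow> x \<in> extensional I" for x
    by (auto simp: M_def space_PiM PiE_def)
  have shift: "(\<integral>\<^sup>+x. h (\<lambda>i\<in>I. x i + v i) \<partial>M I) = (\<integral>\<^sup>+x. h x \<partial>M I)"
    if "h \<in> borel_measurable (M I)" for h v
    using nn_integral_PiM_lborel_comp[OF I, of "\<lambda>i x. x + v i" h] that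
    by (simp add: M_def distr_lborel_shift)
  have refl: "(\<integral>\<^sup>+x. h (\<lambda>i\<in>I. v i - x i) \<partial>M I) = (\<integral>\<^sup>+x. h x \<partial>M I)"
    if "h \<in> borel_measurable (M I)" for h v
    using nn_integral_PiM_lborel_comp[OF I, of "\<lambda>i x. v i - x" h] that
    by (simp add: M_def distr_lborel_reflect)
  have c[measurable]: "(\<lambda>x. x i) \<in> borel_measurable (M I)" if "i \<in> I" for i
    using that unfolding M_def by (auto intro: measurable_component_singleton)
  \<comment> \<open>Fubini's theorem needs measurability in both variables jointly.\<close>
  have plus[measurable]: "(\<lambda>(x, y). \<lambda>i\<in>I. y i + T x i) \<in> measurable (M I \<Otimes>\<^sub>M M I) (M I)"
    unfolding split_beta'
    by (subst (3) M_def, rule measurable_restrict)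
      (auto intro!: borel_measurable_add measurable_compose[OF _ c] measurable_compose[OF measurable_fst T])
  have minus[measurable]: "(\<lambda>(x, y). \<lambda>i\<in>I. T x i - y i) \<in> measurable (M I \<Otimes>\<^sub>M M I) (M I)"
    unfolding split_beta'
    by (subst (3) M_def, rule measurable_restrict)
      (auto intro!: borel_measurable_diff measurable_compose[OF _ c] measurable_compose[OF measurable_fst T])
  have fplus[measurable]: "(\<lambda>(x, y). g (\<lambda>i\<in>I. y i + T x i)) \<in> borel_measurable (M I \<Otimes>\<^sub>M M I)"
    using measurable_compose[OF plus g] by (simp add: split_beta')
  have fminus[measurable]: "(\<lambda>(x, y). f (\<lambda>i\<in>I. T x i - y i)) \<in> borel_measurable (M I \<Otimes>\<^sub>M M I)"
    using measurable_compose[OF minus f] by (simp add: split_beta')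
  have Tx: "T x \<in> extensional I" if "x \<in> space (M I)" for x
    using measurable_space[OF T that] by (simp add: sp)
  have "(\<integral>\<^sup>+x. f (T x) \<partial>M I) * (\<integral>\<^sup>+x. g x \<partial>M I) = (\<integral>\<^sup>+x. \<integral>\<^sup>+y. f (T x) * g y \<partial>M I \<partial>M I)"
    by (simp add: nn_integral_cmult nn_integral_multc)
  also have "\<dots> = (\<integral>\<^sup>+x. \<integral>\<^sup>+y. f (T x) * g (\<lambda>i\<in>I. y i + T x i) \<partial>M I \<partial>M I)"
    by (intro nn_integral_cong shift[symmetric]) simp
  also have "\<dots> = (\<integral>\<^sup>+y. \<integral>\<^sup>+x. f (T x) * g (\<lambda>i\<in>I. y i + T x i) \<partial>M I \<partial>M I)"
    by (rule P.Fubini'[symmetric]) measurable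
  also have "\<dots> = (\<integral>\<^sup>+y. \<integral>\<^sup>+x. f (\<lambda>i\<in>I. T x i - y i) * g (T x) \<partial>M I \<partial>M I)"
  proof (rule nn_integral_cong)
    fix y assume y: "y \<in> space (M I)"
    then obtain w where w: "w \<in> space (M I)" "T w = y"
      using surj by blast
    obtain v where v: "v \<in> space (M I)" "T v = (\<lambda>i\<in>I. - y i)"
      using surj[of "\<lambda>i\<in>I. - y i"] by (auto simp: sp)
    have [measurable]: "(\<lambda>x. g (\<lambda>i\<in>I. y i + T x i)) \<in> borel_measurable (M I)"
      using measurable_compose[OF measurable_Pair1'[OF y] measurable_compose[OF measurable_pair_swap' fplus]]
      by simp
    have "(\<integral>\<^sup>+x. f (T x) * g (\<lambda>i\<in>I. y i + T x i) \<partial>M I) =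
      (\<integral>\<^sup>+x. f (T (\<lambda>i\<in>I. x i + v i)) * g (\<lambda>i\<in>I. y i + T (\<lambda>i\<in>I. x i + v i) i) \<partial>M I)"
      by (rule shift[symmetric]) measurable
    also have "\<dots> = (\<integral>\<^sup>+x. f (\<lambda>i\<in>I. T x i - y i) * g (T x) \<partial>M I)"
    proof (intro nn_integral_cong arg_cong2[where f="(*)"] arg_cong[where f=f] arg_cong[where f=g])
      fix x assume x: "x \<in> space (M I)"
      have *: "T (\<lambda>i\<in>I. x i + v i) = (\<lambda>i\<in>I. T x i - y i)"
        using add[OF x v(1)] v(2) by (auto simp: fun_eq_iff)
      then show "T (\<lambda>i\<in>I. x i + v i) = (\<lambda>i\<in>I. T x i - y i)" .
      show "(\<lambda>i\<in>I. y i + T (\<lambda>i\<in>I. x i + v i) i) = T x"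
        unfolding * using Tx[OF x] by (auto simp: fun_eq_iff extensional_def)
    qed
    finally show "(\<integral>\<^sup>+x. f (T x) * g (\<lambda>i\<in>I. y i + T x i) \<partial>M I) =
      (\<integral>\<^sup>+x. f (\<lambda>i\<in>I. T x i - y i) * g (T x) \<partial>M I)" .
  qed
  also have "\<dots> = (\<integral>\<^sup>+x. \<integral>\<^sup>+y. f (\<lambda>i\<in>I. T x i - y i) * g (T x) \<partial>M I \<partial>M I)"
    by (rule P.Fubini') measurable
  \<comment> \<open>For fixed x the reflection \<open>y \<mapsto> T x - y\<close> preserves the
    measure, which frees f from T.\<close>
  also have "\<dots> = (\<integral>\<^sup>+x. (\<integral>\<^sup>+y. f y \<partial>M I) * g (T x) \<partial>M I)"
  proof (rule nn_integral_cong)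
    fix x assume x: "x \<in> space (M I)"
    have [measurable]: "(\<lambda>y. f (\<lambda>i\<in>I. T x i - y i)) \<in> borel_measurable (M I)"
      using measurable_compose[OF measurable_Pair1'[OF x] fminus] by simp
    show "(\<integral>\<^sup>+y. f (\<lambda>i\<in>I. T x i - y i) * g (T x) \<partial>M I) = (\<integral>\<^sup>+y. f y \<partial>M I) * g (T x)"
      by (simp add: nn_integral_multc refl)
  qed
  also have "\<dots> = (\<integral>\<^sup>+x. g (T x) \<partial>M I) * (\<integral>\<^sup>+x. f x \<partial>M I)"
    by (subst nn_integral_cmult) (simp_all add: mult.commute)
  finally show ?thesis .
qed

text \<open>The integrand factors over the index set and then over an orthonormal basis, so only the
  finiteness of a one-dimensional Gaussian integral matters.\<close>

lemma nn_integral_exp_minus_norm_finite: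
  fixes c :: real assumes c: "c > 0" and I: "finite I"
  shows "(\<integral>\<^sup>+x. ennreal (exp (- c * (\<Sum>i\<in>I. (norm (x i))\<^sup>2))) \<partial>PiM I (\<lambda>_. lborel :: 'a::euclidean_space measure)) < \<infinity>"
proof -
  have 1: "(\<integral>\<^sup>+t. ennreal (exp (- c * t\<^sup>2)) \<partial>lborel) < \<infinity>"
  proof -
    \<comment> \<open>The normal density with variance 1/(2c) has exponent -c t^2.\<close>
    let ?s = "1 / sqrt (2 * c)"
    have e: "exp (- c * t\<^sup>2) = sqrt (2 * pi * ?s\<^sup>2) * normal_density 0 ?s t" for t
      using c by (simp add: normal_density_def field_simps power_divide)
    have "integrable lborel (normal_density 0 ?s)"
      using c by (intro integrable_normal_density) auto
    then have "integrable lborel (\<lambda>t. exp (- c * t\<^sup>2))"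
      unfolding e by simp
    then show ?thesis
      by (simp add: integrable_iff_bounded)
  qed
  have 3: "(\<integral>\<^sup>+v. ennreal (exp (- c * (norm (v :: 'a))\<^sup>2)) \<partial>lborel) < \<infinity>" (is "?I < _")
  proof -
    have n: "(norm v)\<^sup>2 = (\<Sum>b\<in>Basis. (v \<bullet> b)\<^sup>2)" for v :: 'a
      unfolding power2_norm_eq_inner by (subst euclidean_inner) (simp add: power2_eq_square)
    have "?I = (\<integral>\<^sup>+v. (\<Prod>b\<in>Basis. ennreal (exp (- c * ((v :: 'a) \<bullet> b)\<^sup>2))) \<partial>lborel)"
      by (intro nn_integral_cong)
        (simp add: prod_ennreal exp_sum[symmetric] n sum_distrib_left flip: sum_negf)
    also have "\<dots> = (\<Prod>b\<in>(Basis :: 'a set). (\<integral>\<^sup>+t. ennreal (exp (- c * t\<^sup>2)) \<partial>lborel))"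
      using nn_integral_lborel_prod[of "\<lambda>(_ :: 'a) t. ennreal (exp (- c * t\<^sup>2))"] by simp
    also have "\<dots> < \<infinity>"
      using 1 by (simp add: ennreal_prod_eq_top power_eq_top_ennreal less_top[symmetric])
    finally show ?thesis .
  qed
  have "(\<integral>\<^sup>+x. ennreal (exp (- c * (\<Sum>i\<in>I. (norm (x i))\<^sup>2))) \<partial>PiM I (\<lambda>_. lborel :: 'a measure)) =
    (\<integral>\<^sup>+x. (\<Prod>i\<in>I. ennreal (exp (- c * (norm (x i))\<^sup>2))) \<partial>PiM I (\<lambda>_. lborel :: 'a measure))"
    using I by (intro nn_integral_cong) (simp add: prod_ennreal exp_sum[symmetric] sum_distrib_left flip: sum_negf)
  also have "\<dots> = (\<Prod>i\<in>I. (\<integral>\<^sup>+v. ennreal (exp (- c * (norm v)\<^sup>2)) \<partial>(lborel :: 'a measure)))"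
    using I by (intro lborel_prod.product_nn_integral_prod) auto
  also have "\<dots> < \<infinity>"
    using 3 by (simp add: ennreal_prod_eq_top power_eq_top_ennreal less_top[symmetric])
  finally show ?thesis .
qed

section \<open>Moments from the moment generating function\<close>

text \<open>Lagrange form of the second-order remainder. It dominates the rescaled remainders whose
  pointwise limit is computed next.\<close>

lemma abs_exp_minus_linear_le: "\<bar>exp y - 1 - y\<bar> \<le> y\<^sup>2 / 2 * exp \<bar>y\<bar>" for y :: real
proof -
  obtain \<theta> where \<theta>: "\<bar>\<theta>\<bar> \<le> \<bar>y\<bar>" "exp y = (\<Sum>m<2. y ^ m / fact m) + exp \<theta> / fact 2 * y ^ 2"
    using Maclaurin_exp_le[of y 2] by blast
  have "exp y - 1 - y = y\<^sup>2 / 2 * exp \<theta>"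
    using \<theta>(2) by (simp add: numeral_2_eq_2)
  then have "\<bar>exp y - 1 - y\<bar> = y\<^sup>2 / 2 * exp \<theta>"
    by (simp only:) (simp add: abs_mult)
  also have "\<dots> \<le> y\<^sup>2 / 2 * exp \<bar>y\<bar>"
    using \<theta>(1) by (intro mult_left_mono) auto
  finally show ?thesis .
qed

lemma LIMSEQ_exp_second_order:
  "(\<lambda>k. (exp (y / real (Suc k)) - 1 - y / real (Suc k)) * (real (Suc k))\<^sup>2) \<longlonglongrightarrow> y\<^sup>2 / 2" for y :: real
proof -
  \<comment> \<open>The asymptotic expansion is computed with the sign of y fixed.\<close>
  consider "y = 0" | "y > 0" | "y < 0" by linarith
  then show ?thesis
  proof cases
    case 1 then show ?thesis by simp
  next
    case 2 then show ?thesis unfolding power2_eq_square by real_asymp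
  next
    case 3 then show ?thesis unfolding power2_eq_square by real_asymp
  qed
qed

text \<open>The moment generating function is not differentiated under the integral. The mean is
  squeezed by exp y \<ge> 1 + y for t of either sign; the second moment is the limit of the
  expectation of (exp (t X) - 1 - t X) / t^2 along t = 1/(k+1).\<close>

lemma gaussian_moments_of_mgf:
  fixes X :: "'a \<Rightarrow> real" and u :: real
  assumes "prob_space M" and X[measurable]: "X \<in> borel_measurable M"
    and mgf: "\<And>t. (\<integral>\<^sup>+x. ennreal (exp (t * X x)) \<partial>M) = ennreal (exp (t\<^sup>2 * u))"
  shows "integrable M X" "integrable M (\<lambda>x. (X x)\<^sup>2)" "(\<integral>x. X x \<partial>M) = 0" "(\<integral>x. (X x)\<^sup>2 \<partial>M) = 2 * u"
proof -
  interpret prob_space M by fact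
  have e: "integrable M (\<lambda>x. exp (t * X x))" "(\<integral>x. exp (t * X x) \<partial>M) = exp (t\<^sup>2 * u)" for t
    using mgf[of t] by (subst (asm) nn_integral_eq_integrable; simp)+
  \<comment> \<open>A dominating function, integrable by the hypothesis at t = 2 and t = -2: X^2/2
    \<le> exp |X|, and exp (2 |X|) \<le> w.\<close>
  define w where "w x = exp (2 * X x) + exp (- 2 * X x)" for x
  have w: "integrable M w"
    unfolding w_def using e(1)[of 2] e(1)[of "-2"] by simp
  have dom: "(X x)\<^sup>2 / 2 * exp \<bar>X x\<bar> \<le> w x" for x
  proof -
    have "(X x)\<^sup>2 / 2 \<le> exp \<bar>X x\<bar>"
      using exp_lower_Taylor_quadratic[of "\<bar>X x\<bar>"] by simp
    then have "(X x)\<^sup>2 / 2 * exp \<bar>X x\<bar> \<le> exp \<bar>X x\<bar> * exp \<bar>X x\<bar>"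
      by (intro mult_right_mono) auto
    also have "\<dots> = exp (2 * \<bar>X x\<bar>)"
      by (simp flip: exp_add)
    also have "\<dots> \<le> w x"
      unfolding w_def by (cases "X x \<ge> 0") auto
    finally show ?thesis .
  qed
  have dom2: "(X x)\<^sup>2 / 2 \<le> w x" for x
    by (rule order.trans[OF _ dom]) (simp add: mult_le_cancel_left1)
  have sq: "integrable M (\<lambda>x. (X x)\<^sup>2 / 2)"
    by (rule Bochner_Integration.integrable_bound[OF w]) (use dom2 in \<open>auto intro!: AE_I2 order.trans[OF dom2 abs_ge_self] simp del: divide_le_eq_numeral1\<close>)
  show sq': "integrable M (\<lambda>x. (X x)\<^sup>2)"
    using integrable_mult_right[OF sq, of 2] by simp
  show iX: "integrable M X"
    using sq' square_integrable_imp_integrable[OF X] by simp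
  define m where "m = (\<integral>x. X x \<partial>M)"
  have le: "1 + t * m \<le> exp (t\<^sup>2 * u)" for t
  proof -
    have "1 + t * m = (\<integral>x. 1 + t * X x \<partial>M)"
      using iX by (simp add: m_def prob_space)
    also have "\<dots> \<le> (\<integral>x. exp (t * X x) \<partial>M)"
      using iX e(1) by (intro integral_mono) (auto simp: exp_ge_add_one_self)
    finally show ?thesis
      by (simp add: e)
  qed
  \<comment> \<open>Here s is a sign. Dividing 1 + s t m \<le> exp (t^2 u) by t > 0 and letting t
    tend to 0 leaves 0 on the right.\<close>
  have m0: "s * m \<le> 0" if "\<bar>s\<bar> = 1" for s
  proof (rule tendsto_lowerbound)
    show "((\<lambda>t. (exp (t\<^sup>2 * u) - 1) / t) \<longlongrightarrow> 0) (at_right 0)"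
    proof -
      consider "u = 0" | "u > 0" | "u < 0" by linarith
      then show ?thesis
        by cases (simp, real_asymp, real_asymp)
    qed
    show "\<forall>\<^sub>F t in at_right 0. s * m \<le> (exp (t\<^sup>2 * u) - 1) / t"
      using le[of "s * _"] that
      by (intro eventually_at_right_less[THEN eventually_mono])
        (auto simp: field_simps power_mult_distrib abs_square_eq_1 power2_eq_1_iff abs_if split: if_splits)
  qed simp
  show "(\<integral>x. X x \<partial>M) = 0"
    using m0[of 1] m0[of "-1"] by (simp add: m_def)
  then have m: "m = 0" by (simp add: m_def)
  let ?s = "\<lambda>k x. (exp (X x / real (Suc k)) - 1 - X x / real (Suc k)) * (real (Suc k))\<^sup>2"
  have "(\<lambda>k. \<integral>x. ?s k x \<partial>M) \<longlonglongrightarrow> (\<integral>x. (X x)\<^sup>2 / 2 \<partial>M)"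
  proof (rule integral_dominated_convergence[where w = w])
    show "AE x in M. (\<lambda>k. ?s k x) \<longlonglongrightarrow> (X x)\<^sup>2 / 2"
      by (intro AE_I2 LIMSEQ_exp_second_order)
    show "AE x in M. norm (?s k x) \<le> w x" for k
    proof (intro AE_I2)
      fix x
      let ?y = "X x / real (Suc k)"
      have "\<bar>?y\<bar> \<le> \<bar>X x\<bar>"
        by (simp add: divide_le_eq mult_le_cancel_left1 field_simps)
      have "norm (?s k x) = \<bar>exp ?y - 1 - ?y\<bar> * (real (Suc k))\<^sup>2"
        by (simp add: abs_mult)
      also have "\<dots> \<le> ?y\<^sup>2 / 2 * exp \<bar>?y\<bar> * (real (Suc k))\<^sup>2"
        by (intro mult_right_mono abs_exp_minus_linear_le) simp
      also have "\<dots> = (X x)\<^sup>2 / 2 * exp \<bar>?y\<bar>"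
        by (simp add: power_divide)
      also have "\<dots> \<le> (X x)\<^sup>2 / 2 * exp \<bar>X x\<bar>"
        using \<open>\<bar>?y\<bar> \<le> \<bar>X x\<bar>\<close> by (intro mult_left_mono) auto
      finally show "norm (?s k x) \<le> w x"
        using dom[of x] by simp
    qed
  qed (use w in auto)
  \<comment> \<open>The linear term drops out because the mean is already known to vanish.\<close>
  moreover have "(\<integral>x. ?s k x \<partial>M) = (exp (u / (real (Suc k))\<^sup>2) - 1) * (real (Suc k))\<^sup>2" for k
    using e[of "1 / real (Suc k)"] iX m by (simp add: m_def prob_space power_divide)
  moreover have "(\<lambda>k. (exp (u / (real (Suc k))\<^sup>2) - 1) * (real (Suc k))\<^sup>2) \<longlonglongrightarrow> u"
  proof -
    consider "u = 0" | "u > 0" | "u < 0" by linarith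
    then show ?thesis
      by cases (simp, real_asymp, real_asymp)
  qed
  ultimately have "(\<integral>x. (X x)\<^sup>2 / 2 \<partial>M) = u"
    using LIMSEQ_unique by (metis (no_types, lifting) ext)
  then show "(\<integral>x. (X x)\<^sup>2 \<partial>M) = 2 * u"
    by simp
qed

section \<open>The discrete Fourier transform\<close>

text \<open>Inverse of \<open>prev\<close> on the ring. It enters because each layer occurs in U
  also as the predecessor of another one.\<close>

definition next_layer :: "nat \<Rightarrow> nat \<Rightarrow> nat" where
  "next_layer L l = (if l = L then 0 else Suc l)"

text \<open>Summation by parts on a ring, without boundary terms. The summand depends on both ends
  of a bond, so that products of neighbouring layers can be reindexed.\<close>

lemma sum_prev: "(\<Sum>l\<le>L. f l (prev L l)) = (\<Sum>l\<le>L. f (next_layer L l) l)" for f :: "nat \<Rightarrow> nat \<Rightarrow> 'a::comm_monoid_add"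
  by (rule sum.reindex_bij_witness[of _ "next_layer L" "prev L"]) (auto simp: prev_def next_layer_def)

definition phase :: "nat \<Rightarrow> nat \<Rightarrow> nat \<Rightarrow> complex" where
  "phase L n l = cis (wavevector L n * real l)"

text \<open>The phase is e^{iql} because the modes are defined by expanding the fields in e^{-iql}.
  The symmetric normalisation makes the transform unitary.\<close>

definition dft :: "nat \<Rightarrow> (nat \<Rightarrow> complex) \<Rightarrow> nat \<Rightarrow> complex" where
  "dft L f n = complex_of_real (1 / sqrt (real (L + 1))) * (\<Sum>l\<le>L. phase L n l * f l)"

definition idft :: "nat \<Rightarrow> (nat \<Rightarrow> complex) \<Rightarrow> nat \<Rightarrow> complex" where
  "idft L g l = complex_of_real (1 / sqrt (real (L + 1))) * (\<Sum>n\<le>L. cnj (phase L n l) * g n)"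

text \<open>This symmetry turns orthogonality of modes under summation over layers into
  orthogonality of layers under summation over modes.\<close>

lemma phase_commute: "phase L n l = phase L l n"
  by (simp add: phase_def wavevector_def mult_ac)

lemma phase_0 [simp]: "phase L n 0 = 1" "phase L 0 n = 1"
  by (simp_all add: phase_def wavevector_def)

lemma phase_mult_cnj [simp]: "phase L n l * cnj (phase L n l) = 1"
  by (simp add: phase_def cis_cnj cis_mult)

lemma phase_add: "phase L n (l + m) = phase L n l * phase L n m"
  by (simp add: phase_def cis_mult distrib_left)

lemma phase_period: "phase L n (L + 1) = 1"
proof -
  have "wavevector L n * real (L + 1) = 2 * pi * real n"
    by (simp add: wavevector_def)
  then show ?thesis
    by (simp only: phase_def) (simp add: cis_multiple_2pi)
qed

text \<open>The step from layer 0 back to layer L is harmless because the phase has period L + 1 in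
  the layer.\<close>

lemma phase_prev: "l \<le> L \<Longrightarrow> phase L n l = phase L n 1 * phase L n (prev L l)"
  using phase_period[of L n] phase_add[of L n 1 L] phase_add[of L n 1 "l - 1"]
  by (auto simp: prev_def)

lemma phase_next: "phase L n l = cnj (phase L n 1) * phase L n (next_layer L l)"
proof -
  have "phase L n (l + 1) = phase L n (next_layer L l)"
    using phase_period[of L n] by (auto simp: next_layer_def)
  then have "phase L n l * (phase L n 1 * cnj (phase L n 1)) = phase L n (next_layer L l) * cnj (phase L n 1)"
    by (simp only: phase_add mult.assoc [symmetric])
  then show ?thesis
    by (simp add: mult.commute)
qed

lemma phase_neg_mode: "n \<le> L \<Longrightarrow> phase L (neg_mode L n) l = cnj (phase L n l)"
proof (cases "n = 0")
  case False
  assume "n \<le> L"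
  with False have "neg_mode L n = L + 1 - n"
    by (simp add: neg_mode_def)
  with \<open>n \<le> L\<close> have "phase L l n * phase L l (neg_mode L n) = 1"
    using phase_period[of L l] by (simp flip: phase_add)
  then have "cnj (phase L l n) * (phase L l n * phase L l (neg_mode L n)) = cnj (phase L l n)"
    by simp
  then show ?thesis
    using phase_mult_cnj[of L l n] by (simp add: phase_commute[of L _ l] mult.commute flip: mult.assoc)
qed (simp add: neg_mode_def)

lemma phase_orthogonal:
  assumes "n \<le> L" "m \<le> L"
  shows "(\<Sum>l\<le>L. phase L n l * cnj (phase L m l)) = (if n = m then of_nat (L + 1) else 0)"
proof (cases "n = m")
  case False
  let ?t = "2 * pi * (real n - real m) / real (L + 1)"
  let ?r = "cis ?t"
  have pow: "phase L n l * cnj (phase L m l) = ?r ^ l" for l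
  proof -
    have "wavevector L n * real l + - (wavevector L m * real l) = real l * ?t"
      by (simp add: wavevector_def algebra_simps diff_divide_distrib)
    then show ?thesis
      by (simp only: phase_def cis_cnj cis_mult Complex.DeMoivre)
  qed
  have "?r ^ (L + 1) = 1"
    using pow[of "L + 1"] by (simp only: phase_period) simp
  \<comment> \<open>The geometric sum vanishes for a nontrivial (L+1)-th root of unity. If the ratio
    were 1, n - m would be a nonzero multiple of L + 1, but both numbers lie between 0 and
    L.\<close>
  moreover have "?r \<noteq> 1"
  proof
    assume "?r = 1"
    then have "cos ?t = 1"
      by (simp add: complex_eq_iff)
    then obtain k :: int where k: "?t = of_int k * (2 * pi)"
      by (auto simp: cos_one_2pi_int)
    have "2 * pi * (real n - real m) = 2 * pi * (of_int k * real (L + 1))"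
      using k by (simp add: field_simps)
    then have "real_of_int (int n - int m) = real_of_int (k * int (L + 1))"
      by simp
    then have eq: "int n - int m = k * int (L + 1)"
      by (simp only: of_int_eq_iff)
    have "\<bar>int n - int m\<bar> < int (L + 1)"
      using assms by linarith
    moreover have "k \<noteq> 0"
      using eq False by auto
    then have "int (L + 1) \<le> \<bar>k\<bar> * int (L + 1)"
      by (simp add: mult_le_cancel_right1)
    ultimately show False
      unfolding eq by (simp add: abs_mult)
  qed
  ultimately have "(\<Sum>l\<le>L. ?r ^ l) = 0"
    using sum_gp_basic[of ?r L] by simp
  then show ?thesis
    using False by (simp add: pow)
qed simp

lemma phase_orthogonal':
  assumes "l \<le> L" "m \<le> L"
  shows "(\<Sum>n\<le>L. cnj (phase L n l) * phase L n m) = (if l = m then of_nat (L + 1) else 0)"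
  using phase_orthogonal[OF assms(2,1)] by (auto simp: phase_commute[of L _ m] phase_commute[of L _ l] mult.commute)

lemma inverse_sqrt_square:
  "complex_of_real (1 / sqrt (real (L + 1))) * complex_of_real (1 / sqrt (real (L + 1))) * of_nat (L + 1) = 1"
proof -
  have "1 / sqrt (real (L + 1)) * (1 / sqrt (real (L + 1))) * real (L + 1) = 1"
    by (simp add: field_simps)
  from arg_cong[OF this, of complex_of_real] show ?thesis
    by (simp only: of_real_mult of_real_of_nat_eq of_real_1)
qed

lemma idft_dft:
  assumes "l \<le> L" shows "idft L (dft L f) l = f l"
proof -
  let ?c = "complex_of_real (1 / sqrt (real (L + 1)))"
  have "idft L (dft L f) l = ?c * ?c * (\<Sum>n\<le>L. \<Sum>m\<le>L. (cnj (phase L n l) * phase L n m) * f m)"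
    unfolding idft_def dft_def by (simp add: sum_distrib_left mult_ac)
  also have "(\<Sum>n\<le>L. \<Sum>m\<le>L. (cnj (phase L n l) * phase L n m) * f m) =
      (\<Sum>m\<le>L. (\<Sum>n\<le>L. cnj (phase L n l) * phase L n m) * f m)"
    by (subst sum.swap) (simp add: sum_distrib_right)
  also have "\<dots> = of_nat (L + 1) * f l"
    using assms by (simp add: phase_orthogonal' if_distrib[of "\<lambda>c. c * _"] cong: if_cong)
  finally show ?thesis
    using inverse_sqrt_square[of L] by (simp only: mult.assoc [symmetric]) simp
qed

lemma dft_idft:
  assumes "n \<le> L" shows "dft L (idft L g) n = g n"
proof -
  let ?c = "complex_of_real (1 / sqrt (real (L + 1)))"
  have "dft L (idft L g) n = ?c * ?c * (\<Sum>l\<le>L. \<Sum>m\<le>L. (phase L n l * cnj (phase L m l)) * g m)"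
    unfolding idft_def dft_def by (simp add: sum_distrib_left mult_ac)
  also have "(\<Sum>l\<le>L. \<Sum>m\<le>L. (phase L n l * cnj (phase L m l)) * g m) =
      (\<Sum>m\<le>L. (\<Sum>l\<le>L. phase L n l * cnj (phase L m l)) * g m)"
    by (subst sum.swap) (simp add: sum_distrib_right)
  also have "\<dots> = of_nat (L + 1) * g n"
    using assms by (simp add: phase_orthogonal if_distrib[of "\<lambda>c. c * _"] cong: if_cong)
  finally show ?thesis
    using inverse_sqrt_square[of L] by (simp only: mult.assoc [symmetric]) simp
qed

lemma dft_cong: "(\<And>l. l \<le> L \<Longrightarrow> f l = g l) \<Longrightarrow> dft L f n = dft L g n"
  unfolding dft_def by simp

lemma idft_cong: "(\<And>n. n \<le> L \<Longrightarrow> f n = g n) \<Longrightarrow> idft L f l = idft L g l"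
  unfolding idft_def by simp

text \<open>Exchanging the sums exhibits \<open>idft\<close> as the adjoint of \<open>dft\<close>;
  the inversion formula does the rest.\<close>

lemma parseval: "(\<Sum>n\<le>L. cnj (dft L f n) * dft L g n) = (\<Sum>l\<le>L. cnj (f l) * g l)"
proof -
  have "(\<Sum>n\<le>L. cnj (dft L f n) * dft L g n) = (\<Sum>l\<le>L. cnj (f l) * idft L (dft L g) l)"
    unfolding dft_def[of L f] idft_def
    by (simp add: sum_distrib_left sum_distrib_right mult_ac) (rule sum.swap)
  then show ?thesis
    by (simp add: idft_dft)
qed

lemma dft_prev: "dft L (\<lambda>l. f (prev L l)) n = phase L n 1 * dft L f n"
proof -
  have "(\<Sum>l\<le>L. phase L n l * f (prev L l)) = phase L n 1 * (\<Sum>l\<le>L. phase L n (prev L l) * f (prev L l))"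
    by (simp add: sum_distrib_left phase_prev[symmetric] flip: mult.assoc del: One_nat_def)
  also have "(\<Sum>l\<le>L. phase L n (prev L l) * f (prev L l)) = (\<Sum>l\<le>L. phase L n l * f l)"
    by (rule sum_prev)
  finally show ?thesis
    by (simp add: dft_def)
qed

lemma dft_next: "dft L (\<lambda>l. f (next_layer L l)) n = cnj (phase L n 1) * dft L f n"
proof -
  have "(\<Sum>l\<le>L. phase L n l * f (next_layer L l)) = cnj (phase L n 1) * (\<Sum>l\<le>L. phase L n (next_layer L l) * f (next_layer L l))"
    by (simp add: sum_distrib_left phase_next[symmetric] flip: mult.assoc del: One_nat_def)
  also have "(\<Sum>l\<le>L. phase L n (next_layer L l) * f (next_layer L l)) = (\<Sum>l\<le>L. phase L n l * f l)"
    by (rule sum_prev[symmetric])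
  finally show ?thesis
    by (simp add: dft_def)
qed

lemma dft_add: "dft L (\<lambda>l. f l + g l) n = dft L f n + dft L g n"
  by (simp add: dft_def distrib_left sum.distrib)

lemma dft_diff: "dft L (\<lambda>l. f l - g l) n = dft L f n - dft L g n"
  by (simp add: dft_def right_diff_distrib sum_subtractf)

lemma dft_cmult: "dft L (\<lambda>l. c * f l) n = c * dft L f n"
  by (simp add: dft_def sum_distrib_left mult_ac)

lemma dft_neg_mode: "n \<le> L \<Longrightarrow> dft L f (neg_mode L n) = cnj (dft L (\<lambda>l. cnj (f l)) n)"
  by (simp add: dft_def phase_neg_mode)

lemma sum_neg_mode: "(\<Sum>n\<le>L. f (neg_mode L n)) = (\<Sum>n\<le>L. f n)"
  by (rule sum.reindex_bij_witness[of _ "neg_mode L" "neg_mode L"]) (auto simp: neg_mode_le neg_mode_neg_mode)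

text \<open>Conjugation maps the term of a mode to the term of its negative, and the sum runs over
  all modes. This is why every element of \<open>real_modes\<close> comes from a real field.\<close>

lemma cnj_idft:
  assumes "\<And>n. n \<le> L \<Longrightarrow> g (neg_mode L n) = cnj (g n)"
  shows "cnj (idft L g l) = idft L g l"
proof -
  have "(\<Sum>n\<le>L. phase L n l * cnj (g n)) = (\<Sum>n\<le>L. cnj (phase L (neg_mode L n) l) * g (neg_mode L n))"
    using assms by (simp add: phase_neg_mode)
  also have "\<dots> = (\<Sum>n\<le>L. cnj (phase L n l) * g n)"
    by (rule sum_neg_mode)
  finally show ?thesis
    by (simp add: idft_def)
qed

text \<open>Explicit candidate for the definite description \<open>to_modes\<close>, extensional as
  required there.\<close>

definition field_dft :: "nat \<Rightarrow> (nat \<Rightarrow> real^3) \<Rightarrow> (nat \<Rightarrow> complex^3)" where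
  "field_dft L x = (\<lambda>n\<in>{..L}. \<chi> a. dft L (\<lambda>l. complex_of_real (x l $ a)) n)"

lemma fourier_modes_iff_idft:
  "fourier_modes L x z \<longleftrightarrow> (\<forall>l\<le>L. \<forall>a. complex_of_real (x l $ a) = idft L (\<lambda>n. z n $ a) l)"
proof -
  have "exp (- \<i> * complex_of_real (wavevector L n) * of_nat l) = cnj (phase L n l)" for n l
    by (simp add: phase_def cis_conv_exp exp_cnj mult_ac)
  then show ?thesis
    unfolding fourier_modes_def idft_def by simp
qed

lemma fourier_modes_iff:
  "fourier_modes L x z \<longleftrightarrow> (\<forall>n\<le>L. z n = field_dft L x n)"
proof
  assume "fourier_modes L x z"
  then have "dft L (\<lambda>l. complex_of_real (x l $ a)) n = dft L (idft L (\<lambda>n. z n $ a)) n" for n a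
    by (intro dft_cong) (auto simp: fourier_modes_iff_idft)
  then show "\<forall>n\<le>L. z n = field_dft L x n"
    by (auto simp: field_dft_def vec_eq_iff dft_idft)
next
  assume z: "\<forall>n\<le>L. z n = field_dft L x n"
  have "idft L (\<lambda>n. z n $ a) l = idft L (dft L (\<lambda>l. complex_of_real (x l $ a))) l" for l a
    using z by (intro idft_cong) (auto simp: field_dft_def)
  then show "fourier_modes L x z"
    by (auto simp: fourier_modes_iff_idft idft_dft)
qed

lemma ex1_fourier_modes: "\<exists>!z. z \<in> extensional {..L} \<and> fourier_modes L x z"
  by (rule ex1I[of _ "field_dft L x"])
    (auto simp: fourier_modes_iff field_dft_def extensional_def fun_eq_iff)

lemma to_modes_eq: "to_modes L x = field_dft L x"
  unfolding to_modes_def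
  by (rule the1_equality[OF ex1_fourier_modes]) (auto simp: fourier_modes_iff field_dft_def)

lemma to_modes_real: "to_modes L x \<in> real_modes L"
  by (auto simp: to_modes_eq field_dft_def real_modes_def neg_mode_le dft_neg_mode)

lemma bij_betw_to_modes: "bij_betw (to_modes L) (extensional {..L}) (real_modes L)"
proof (rule bij_betw_imageI)
  have recover: "complex_of_real (x l $ a) = idft L (\<lambda>n. to_modes L x n $ a) l" if "l \<le> L" for x l a
    using that fourier_modes_iff[of L x "to_modes L x"] by (auto simp: to_modes_eq fourier_modes_iff_idft)
  show "inj_on (to_modes L) (extensional {..L})"
  proof (rule inj_onI)
    fix x y assume xy: "x \<in> extensional {..L}" "y \<in> extensional {..L}" "to_modes L x = to_modes L y"
    have "x l = y l" if "l \<le> L" for l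
      using recover[OF that, of x] recover[OF that, of y] xy(3)
      by (metis of_real_eq_iff vec_eq_iff)
    with xy show "x = y"
      by (auto intro: extensionalityI)
  qed
  show "to_modes L ` extensional {..L} = real_modes L"
  proof (intro equalityI subsetI)
    fix z assume "z \<in> to_modes L ` extensional {..L}"
    then show "z \<in> real_modes L"
      by (auto simp: to_modes_real)
  next
    fix z assume z: "z \<in> real_modes L"
    \<comment> \<open>Taking \<open>Re\<close> loses nothing: the conjugation symmetry of z makes
      the inverse transform real.\<close>
    define x where "x = (\<lambda>l\<in>{..L}. \<chi> a. Re (idft L (\<lambda>n. z n $ a) l))"
    have "fourier_modes L x z"
      unfolding fourier_modes_iff_idft
    proof (intro allI impI)
      fix l a assume "l \<le> L"
      have "cnj (idft L (\<lambda>n. z n $ a) l) = idft L (\<lambda>n. z n $ a) l"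
        using z by (intro cnj_idft) (auto simp: real_modes_def)
      then show "complex_of_real (x l $ a) = idft L (\<lambda>n. z n $ a) l"
        using \<open>l \<le> L\<close> by (simp add: x_def complex_eq_iff)
    qed
    then have "to_modes L x = z"
      unfolding to_modes_def using z by (intro the1_equality[OF ex1_fourier_modes]) (auto simp: real_modes_def)
    moreover have "x \<in> extensional {..L}"
      by (simp add: x_def)
    ultimately show "z \<in> to_modes L ` extensional {..L}"
      by blast
  qed
qed

section \<open>The energy and its gradient\<close>

text \<open>The coupling between layers l - 1 and l is differentiated at both ends: as later layer,
  l receives \<open>prev\<close> terms in components 1 and 2; as earlier layer, it receives the two
  \<open>next_layer\<close> terms in component 1.\<close>

definition energy_grad :: "real \<Rightarrow> nat \<Rightarrow> (nat \<Rightarrow> real^3) \<Rightarrow> nat \<Rightarrow> real^3" where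
  "energy_grad \<sigma> L x l = vector
    [(1 + \<sigma>^4 / 2) * x l $ 1 + x l $ 3 / 2 - \<sigma>\<^sup>2 / 2 * (x (prev L l) $ 1 + x (next_layer L l) $ 1 + x (next_layer L l) $ 2),
     x l $ 2 - x l $ 3 / 2 - \<sigma>\<^sup>2 / 2 * x (prev L l) $ 1,
     3 * x l $ 3 + (x l $ 1 - x l $ 2) / 2]"

text \<open>Reindexing the bonds by \<open>sum_prev\<close> removes \<open>next_layer\<close> and
  leaves a form visibly symmetric in v and x, from which the quadratic form, the symmetry of the
  Hessian and the expansion of the energy can be read off term by term.\<close>

lemma sum_inner_energy_grad:
  "(\<Sum>l\<le>L. v l \<bullet> energy_grad \<sigma> L x l) =
   (\<Sum>l\<le>L. (1 + \<sigma>^4 / 2) * (v l $ 1 * x l $ 1) + v l $ 2 * x l $ 2 + 3 * (v l $ 3 * x l $ 3)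
     + (v l $ 3 * (x l $ 1 - x l $ 2) + x l $ 3 * (v l $ 1 - v l $ 2)) / 2
     - \<sigma>\<^sup>2 / 2 * (x (prev L l) $ 1 * (v l $ 1 + v l $ 2) + v (prev L l) $ 1 * (x l $ 1 + x l $ 2)))"
  (is "_ = ?r")
proof -
  have "(\<Sum>l\<le>L. v l \<bullet> energy_grad \<sigma> L x l) =
   (\<Sum>l\<le>L. (1 + \<sigma>^4 / 2) * (v l $ 1 * x l $ 1) + v l $ 2 * x l $ 2 + 3 * (v l $ 3 * x l $ 3)
     + (v l $ 3 * (x l $ 1 - x l $ 2) + x l $ 3 * (v l $ 1 - v l $ 2)) / 2
     - \<sigma>\<^sup>2 / 2 * (x (prev L l) $ 1 * (v l $ 1 + v l $ 2)))
   - (\<Sum>l\<le>L. \<sigma>\<^sup>2 / 2 * (v l $ 1 * (x (next_layer L l) $ 1 + x (next_layer L l) $ 2)))"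
    unfolding sum_subtractf[symmetric]
    by (intro sum.cong refl) (simp add: inner_vec_def sum_3 energy_grad_def vector_3, algebra)
  also have "(\<Sum>l\<le>L. \<sigma>\<^sup>2 / 2 * (v l $ 1 * (x (next_layer L l) $ 1 + x (next_layer L l) $ 2))) =
    (\<Sum>l\<le>L. \<sigma>\<^sup>2 / 2 * (v (prev L l) $ 1 * (x l $ 1 + x l $ 2)))"
    by (rule sum_prev[symmetric])
  finally show ?thesis
    unfolding sum_subtractf[symmetric] by (simp add: algebra_simps)
qed

lemma energy_eq_grad: "energy \<sigma> L x = (\<Sum>l\<le>L. x l \<bullet> energy_grad \<sigma> L x l) / 2"
  unfolding sum_inner_energy_grad energy_def sum_distrib_left sum_divide_distrib
  by (intro sum.cong refl) (simp add: power2_eq_square field_simps)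

lemma energy_grad_sym:
  "(\<Sum>l\<le>L. v l \<bullet> energy_grad \<sigma> L x l) = (\<Sum>l\<le>L. x l \<bullet> energy_grad \<sigma> L v l)"
  unfolding sum_inner_energy_grad by (intro sum.cong refl) (simp add: algebra_simps)

text \<open>Taylor expansion, exact for a quadratic form. The condition on y is confined to the ring
  because translated configurations are restricted to it.\<close>

lemma energy_add:
  assumes y: "\<And>l. l \<le> L \<Longrightarrow> y l = x l + t *\<^sub>R v l"
  shows "energy \<sigma> L y = energy \<sigma> L x + t * (\<Sum>l\<le>L. v l \<bullet> energy_grad \<sigma> L x l) + t\<^sup>2 * energy \<sigma> L v"
proof -
  have p: "prev L l \<le> L" if "l \<le> L" for l
    using that by (auto simp: prev_def)
  show ?thesis
    unfolding sum_inner_energy_grad energy_def sum_distrib_left sum.distrib[symmetric]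
    by (intro sum.cong refl) (simp add: y p power2_eq_square, algebra)
qed

lemma exp_wavevector:
  "exp (\<i> * complex_of_real (wavevector L n)) = phase L n 1"
  "exp (- \<i> * complex_of_real (wavevector L n)) = cnj (phase L n 1)"
  "complex_of_real (cos (wavevector L n)) = (phase L n 1 + cnj (phase L n 1)) / 2"
  by (simp_all add: phase_def cis_conv_exp exp_cnj complex_eq_iff Re_exp Im_exp)

text \<open>The two shifts of eps_+ contribute e^{iq} and e^{-iq}, which add up to the cosine on the
  diagonal; the single shifts between eps_+ and eps_- give the off-diagonal phases.\<close>

lemma Sigma_inv_mult_dft:
  assumes "n \<le> L"
  shows "(Sigma_inv \<sigma> (wavevector L n) *v field_dft L x n) $ a =
    dft L (\<lambda>l. complex_of_real (energy_grad \<sigma> L x l $ a)) n"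
proof -
  let ?x = "\<lambda>a l. complex_of_real (x l $ a)"
  have 1: "dft L (\<lambda>l. complex_of_real (energy_grad \<sigma> L x l $ 1)) n =
     complex_of_real (1 + \<sigma>^4 / 2) * dft L (?x 1) n + 1/2 * dft L (?x 3) n
     - complex_of_real (\<sigma>\<^sup>2 / 2) * (dft L (\<lambda>l. ?x 1 (prev L l)) n + dft L (\<lambda>l. ?x 1 (next_layer L l)) n + dft L (\<lambda>l. ?x 2 (next_layer L l)) n)"
    unfolding dft_cmult[symmetric] dft_add[symmetric] dft_diff[symmetric]
    by (simp add: energy_grad_def vector_3)
  have 2: "dft L (\<lambda>l. complex_of_real (energy_grad \<sigma> L x l $ 2)) n =
     dft L (?x 2) n - 1/2 * dft L (?x 3) n - complex_of_real (\<sigma>\<^sup>2 / 2) * dft L (\<lambda>l. ?x 1 (prev L l)) n"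
    unfolding dft_cmult[symmetric] dft_add[symmetric] dft_diff[symmetric]
    by (simp add: energy_grad_def vector_3)
  have 3: "dft L (\<lambda>l. complex_of_real (energy_grad \<sigma> L x l $ 3)) n =
     3 * dft L (?x 3) n + 1/2 * (dft L (?x 1) n - dft L (?x 2) n)"
    unfolding dft_cmult[symmetric] dft_add[symmetric] dft_diff[symmetric]
    by (simp add: energy_grad_def vector_3)
  have M: "(Sigma_inv \<sigma> (wavevector L n) *v field_dft L x n) $ a =
     (\<Sum>b\<in>UNIV. Sigma_inv \<sigma> (wavevector L n) $ a $ b * dft L (?x b) n)" for a
    using assms by (simp add: matrix_vector_mult_def field_dft_def)
  note dn = dft_prev[of L "?x 1"] dft_next[of L "?x 1"] dft_next[of L "?x 2"]
  have "\<forall>a. (Sigma_inv \<sigma> (wavevector L n) *v field_dft L x n) $ a =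
    dft L (\<lambda>l. complex_of_real (energy_grad \<sigma> L x l $ a)) n"
    unfolding forall_3 M sum_3 1 2 3 dn
    by (simp only: Sigma_inv_def vector_3 of_real_diff of_real_add of_real_mult exp_wavevector)
      (simp add: field_simps)
  then show ?thesis by blast
qed

lemma mode_energy_eq:
  assumes "fourier_modes L x z"
  shows "complex_of_real (energy \<sigma> L x) = mode_energy \<sigma> L z"
proof -
  have z: "z n = field_dft L x n" if "n \<le> L" for n
    using assms that by (simp add: fourier_modes_iff)
  have "z (neg_mode L n) $ a * (Sigma_inv \<sigma> (wavevector L n) *v z n) $ a =
      cnj (dft L (\<lambda>l. complex_of_real (x l $ a)) n) *
      dft L (\<lambda>l. complex_of_real (energy_grad \<sigma> L x l $ a)) n" if "n \<le> L" for n a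
    using that by (simp add: z neg_mode_le Sigma_inv_mult_dft)
      (simp add: field_dft_def neg_mode_le dft_neg_mode)
  then have "mode_energy \<sigma> L z = 1/2 * (\<Sum>n\<le>L. \<Sum>a\<in>UNIV.
      cnj (dft L (\<lambda>l. complex_of_real (x l $ a)) n) *
      dft L (\<lambda>l. complex_of_real (energy_grad \<sigma> L x l $ a)) n)"
    unfolding mode_energy_def by simp
  also have "\<dots> = 1/2 * (\<Sum>a\<in>UNIV. \<Sum>l\<le>L. complex_of_real (x l $ a * energy_grad \<sigma> L x l $ a))"
    by (subst sum.swap) (simp add: parseval)
  also have "\<dots> = complex_of_real (energy \<sigma> L x)"
    unfolding energy_eq_grad by (subst sum.swap) (simp add: inner_vec_def)
  finally show ?thesis ..
qed

text \<open>Eliminating k first lowers the coefficient of m^2 to 1 - 1/12 = 11/12; eliminating m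
  then leaves a form in p and p'.\<close>

lemma site_energy_completed_square:
  fixes p m k p' s :: real
  shows "(1 + s\<^sup>2 / 2) * p\<^sup>2 + m\<^sup>2 + 3 * k\<^sup>2 + k * (p - m) - s * p' * (p + m) =
    3 * (k + (p - m) / 6)\<^sup>2 + 11 / 12 * (m + (p - 6 * s * p') / 11)\<^sup>2
    + (10 / 11 + s\<^sup>2 / 2) * p\<^sup>2 - 3 / 11 * s\<^sup>2 * p'\<^sup>2 - 10 / 11 * s * p * p'"
  by (simp add: power2_eq_square field_simps)

text \<open>Here \<open>p'\<close> is the value of \<open>\<epsilon>\<^sub>+\<close> on the previous layer, or \<open>e\<^sup>i\<^sup>q \<epsilon>\<^sub>+\<close> for a single mode.
  The last term telescopes around the ring, and vanishes for a single mode.\<close>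

lemma site_energy_ge:
  fixes p m k p' s :: real
  assumes "0 < s" "s < 2"
  shows "(1 + s\<^sup>2 / 2) * p\<^sup>2 + m\<^sup>2 + 3 * k\<^sup>2 + k * (p - m) - s * p' * (p + m) \<ge>
    (1 - s / 2)\<^sup>2 / 100 * (p\<^sup>2 + m\<^sup>2 + k\<^sup>2)
    + (3 / 11 * s\<^sup>2 + 5 / 11 * s + (1 - s / 2)\<^sup>2 * 4 / 10) * (p\<^sup>2 - p'\<^sup>2)"
proof -
  \<comment> \<open>The factor (1 - s/2)^2 is the gap that closes at s = 2; the divisor 100 is
    generous, so that the losses below fit into the squares of K and D.\<close>
  define e where "e = (1 - s / 2)\<^sup>2 / 100"
  define K where "K = k + (p - m) / 6"
  define D where "D = m + (p - 6 * s * p') / 11"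
  have e: "0 \<le> e" "e \<le> 1 / 100"
    using assms by (auto simp: e_def abs_square_le_1 power_le_one)
  have k2: "k\<^sup>2 \<le> 2 * K\<^sup>2 + (p\<^sup>2 + m\<^sup>2) / 9"
  proof -
    have "2 * K\<^sup>2 + (p\<^sup>2 + m\<^sup>2) / 9 - k\<^sup>2 = (K + (p - m) / 6)\<^sup>2 + (p + m)\<^sup>2 / 18"
      unfolding K_def by (simp add: power2_eq_square field_simps)
    then show ?thesis
      by (metis add_nonneg_nonneg diff_ge_0_iff_ge divide_nonneg_nonneg zero_le_numeral zero_le_power2)
  qed
  \<comment> \<open>With s < 2 the coefficient of p'^2 comes out as 2 * 288 / 121, which is below
    5.\<close>
  have m2: "m\<^sup>2 \<le> 2 * D\<^sup>2 + 5 * (p\<^sup>2 + p'\<^sup>2)"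
  proof -
    have "2 * D\<^sup>2 + 2 * ((p - 6 * s * p') / 11)\<^sup>2 - m\<^sup>2 = (D + (p - 6 * s * p') / 11)\<^sup>2"
      unfolding D_def by (simp add: power2_eq_square field_simps)
    moreover have "((p - 6 * s * p') / 11)\<^sup>2 = (p - 6 * s * p')\<^sup>2 / 121"
      by (simp add: power_divide)
    ultimately have "m\<^sup>2 \<le> 2 * D\<^sup>2 + 2 * ((p - 6 * s * p')\<^sup>2 / 121)"
      by (metis diff_ge_0_iff_ge zero_le_power2)
    moreover have "(p - 6 * s * p')\<^sup>2 \<le> 2 * p\<^sup>2 + 72 * (s\<^sup>2 * p'\<^sup>2)"
      using zero_le_power2[of "p + 6 * s * p'"] by (simp add: power2_eq_square algebra_simps)
    moreover have "s\<^sup>2 * p'\<^sup>2 \<le> 4 * p'\<^sup>2"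
      using assms power_mono[of s 2 2] by (intro mult_right_mono) auto
    moreover have "M \<le> 2 * D2 + 2 * (Q / 121) \<Longrightarrow> Q \<le> 2 * P + 72 * R \<Longrightarrow> R \<le> 4 * P' \<Longrightarrow>
        0 \<le> P \<Longrightarrow> 0 \<le> P' \<Longrightarrow> M \<le> 2 * D2 + 5 * (P + P')" for M D2 P P' Q R :: real
      by (simp add: field_simps)
    ultimately show ?thesis
      using zero_le_power2 by blast
  qed
  \<comment> \<open>Equality holds at p = p', the uniform configuration, so the critical value of s
    is not worsened.\<close>
  have pp: "10 / 11 * s * p * p' \<le> 5 / 11 * s * (p\<^sup>2 + p'\<^sup>2)"
  proof -
    have "5 / 11 * s * (p\<^sup>2 + p'\<^sup>2) - 10 / 11 * s * p * p' = 5 / 11 * (s * (p - p')\<^sup>2)"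
      by (simp add: power2_eq_square algebra_simps)
    moreover have "0 \<le> 5 / 11 * (s * (p - p')\<^sup>2)"
      using assms by simp
    ultimately show ?thesis
      by linarith
  qed
  have "e * (p\<^sup>2 + m\<^sup>2 + k\<^sup>2) \<le> e * (p\<^sup>2 + (m\<^sup>2 + (2 * K\<^sup>2 + (p\<^sup>2 + m\<^sup>2) / 9)))"
    using k2 e by (intro mult_left_mono) auto
  also have "\<dots> \<le> e * (10/9 * p\<^sup>2 + 10/9 * (2 * D\<^sup>2 + 5 * (p\<^sup>2 + p'\<^sup>2)) + 2 * K\<^sup>2)"
    using m2 e by (intro mult_left_mono) (auto simp: field_simps)
  also have "\<dots> = (60/9 * e * p\<^sup>2 + 50/9 * e * p'\<^sup>2) + 20 / 9 * (e * D\<^sup>2) + 2 * (e * K\<^sup>2)"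
    by (simp add: algebra_simps)
  also have "\<dots> \<le> (60/9 * e * p\<^sup>2 + 50/9 * e * p'\<^sup>2) + 20 / 9 * (1 / 100 * D\<^sup>2) + 2 * (1 / 100 * K\<^sup>2)"
    using e by (intro add_mono mult_left_mono mult_right_mono) auto
  finally have 1: "e * (p\<^sup>2 + m\<^sup>2 + k\<^sup>2) \<le> 60/9 * (e * p\<^sup>2) + 50/9 * (e * p'\<^sup>2) + 11 / 12 * D\<^sup>2 + 3 * K\<^sup>2"
    using zero_le_power2[of D] zero_le_power2[of K] by linarith
  have "(10 / 11 + s\<^sup>2 / 2) * p\<^sup>2 - 3 / 11 * s\<^sup>2 * p'\<^sup>2 - 5 / 11 * s * (p\<^sup>2 + p'\<^sup>2) =
    100 * (10 / 11 * (e * p\<^sup>2)) + (3 / 11 * s\<^sup>2 + 5 / 11 * s) * (p\<^sup>2 - p'\<^sup>2)"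
    unfolding e_def by (simp add: power2_eq_square field_simps)
  moreover have "0 \<le> e * p\<^sup>2" "0 \<le> e * p'\<^sup>2"
    using e by auto
  \<comment> \<open>Squares become variables, leaving linear arithmetic. The surplus 1000/11 E sits
    on p alone, while the losses are 60/9 E and 50/9 E'. Adding 40 E - 40 E' to the telescoping part
    trades some of the surplus for p'.\<close>
  moreover have "A - B - C = 100 * (10 / 11 * E) + T \<Longrightarrow> 0 \<le> E \<Longrightarrow> 0 \<le> E' \<Longrightarrow>
      N \<le> 60/9 * E + 50/9 * E' + 11 / 12 * D' + 3 * K' \<Longrightarrow> X \<le> C \<Longrightarrow>
      N + (T + (40 * E - 40 * E')) \<le> 3 * K' + 11 / 12 * D' + A - B - X" for A B C D' E E' K' N T X :: real
    by (simp add: field_simps)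
  ultimately have "e * (p\<^sup>2 + m\<^sup>2 + k\<^sup>2) + ((3 / 11 * s\<^sup>2 + 5 / 11 * s) * (p\<^sup>2 - p'\<^sup>2) + (40 * (e * p\<^sup>2) - 40 * (e * p'\<^sup>2)))
    \<le> 3 * K\<^sup>2 + 11 / 12 * D\<^sup>2 + (10 / 11 + s\<^sup>2 / 2) * p\<^sup>2 - 3 / 11 * s\<^sup>2 * p'\<^sup>2 - 10 / 11 * s * p * p'"
    using 1 pp by blast
  moreover have "(3 / 11 * s\<^sup>2 + 5 / 11 * s) * (p\<^sup>2 - p'\<^sup>2) + (40 * (e * p\<^sup>2) - 40 * (e * p'\<^sup>2)) =
    (3 / 11 * s\<^sup>2 + 5 / 11 * s + (1 - s / 2)\<^sup>2 * 4 / 10) * (p\<^sup>2 - p'\<^sup>2)"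
    by (simp add: e_def field_simps)
  ultimately show ?thesis
    unfolding site_energy_completed_square K_def[symmetric] D_def[symmetric] e_def[symmetric] by (simp only:)
qed

lemma energy_coercive:
  assumes "0 < \<sigma>\<^sup>2" "\<sigma>\<^sup>2 < 2"
  obtains c where "c > 0" "\<And>x. energy \<sigma> L x \<ge> c * (\<Sum>l\<le>L. (norm (x l))\<^sup>2)"
proof
  let ?s = "\<sigma>\<^sup>2"
  let ?c = "(1 - ?s / 2)\<^sup>2 / 100 / 2"
  let ?d = "3 / 11 * ?s\<^sup>2 + 5 / 11 * ?s + (1 - ?s / 2)\<^sup>2 * 4 / 10"
  show "?c > 0"
    using assms by simp
  fix x :: "nat \<Rightarrow> real^3"
  have n: "(norm v)\<^sup>2 = (v $ 1)\<^sup>2 + (v $ 2)\<^sup>2 + (v $ 3)\<^sup>2" for v :: "real^3"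
    unfolding power2_norm_eq_inner by (simp add: inner_vec_def sum_3 power2_eq_square)
  have tele: "(\<Sum>l\<le>L. ?d * ((x l $ 1)\<^sup>2 - (x (prev L l) $ 1)\<^sup>2)) = 0"
    using sum_prev[of "\<lambda>_ l. (x l $ 1)\<^sup>2" L] unfolding sum_distrib_left[symmetric] sum_subtractf by simp
  have "(\<Sum>l\<le>L. (1 - ?s / 2)\<^sup>2 / 100 * (norm (x l))\<^sup>2) =
      (\<Sum>l\<le>L. (1 - ?s / 2)\<^sup>2 / 100 * (norm (x l))\<^sup>2 + ?d * ((x l $ 1)\<^sup>2 - (x (prev L l) $ 1)\<^sup>2))"
    unfolding sum.distrib tele by simp
  also have "\<dots> \<le> 2 * energy \<sigma> L x"
    unfolding energy_def using site_energy_ge[OF assms] n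
    by (simp add: sum_mono flip: power_mult)
  finally show "energy \<sigma> L x \<ge> ?c * (\<Sum>l\<le>L. (norm (x l))\<^sup>2)"
    unfolding sum_distrib_left[symmetric] by linarith
qed

text \<open>The Hermitian form is the site energy of the real parts plus that of the imaginary
  parts, with the previous layer replaced by a phase times the first component. Rotation preserves
  the modulus, so the telescoping terms cancel in the sum.\<close>

lemma pos_def_hermitian_Sigma_inv:
  assumes "0 < \<sigma>\<^sup>2" "\<sigma>\<^sup>2 < 2"
  shows "pos_def_hermitian (Sigma_inv \<sigma> q)"
  unfolding pos_def_hermitian_def
proof (intro conjI allI impI)
  have e: "exp (\<i> * complex_of_real q) = Complex (cos q) (sin q)"
    "exp (- (\<i> * complex_of_real q)) = Complex (cos q) (- sin q)"
    by (simp_all add: complex_eq_iff Re_exp Im_exp)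
  show "Sigma_inv \<sigma> q $ b $ a = cnj (Sigma_inv \<sigma> q $ a $ b)" for a b
  proof -
    have "\<forall>a b. Sigma_inv \<sigma> q $ b $ a = cnj (Sigma_inv \<sigma> q $ a $ b)"
      unfolding forall_3 by (simp add: Sigma_inv_def vector_3 e complex_eq_iff)
    then show ?thesis by blast
  qed
  fix v :: "complex^3" assume v: "v \<noteq> 0"
  let ?s = "\<sigma>\<^sup>2"
  define p' where "p' = Complex (cos q) (sin q) * v $ 1"
  have p': "(Re p')\<^sup>2 + (Im p')\<^sup>2 = (Re (v $ 1))\<^sup>2 + (Im (v $ 1))\<^sup>2"
    using arg_cong[OF norm_mult[of "Complex (cos q) (sin q)" "v $ 1"], of "\<lambda>x. x\<^sup>2"]
    by (simp add: p'_def[symmetric] cmod_power2 power_mult_distrib)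
  let ?f = "\<lambda>R. (1 + ?s\<^sup>2 / 2) * (R (v $ 1))\<^sup>2 + (R (v $ 2))\<^sup>2 + 3 * (R (v $ 3))\<^sup>2
    + R (v $ 3) * (R (v $ 1) - R (v $ 2)) - ?s * R p' * (R (v $ 1) + R (v $ 2)) :: real"
  let ?c = "(1 - ?s / 2)\<^sup>2 / 100"
  let ?n = "\<lambda>R. (R (v $ 1))\<^sup>2 + (R (v $ 2))\<^sup>2 + (R (v $ 3))\<^sup>2 :: real"
  let ?d = "3 / 11 * ?s\<^sup>2 + 5 / 11 * ?s + (1 - ?s / 2)\<^sup>2 * 4 / 10"
  have form: "Re (\<Sum>a\<in>UNIV. cnj (v $ a) * (Sigma_inv \<sigma> q *v v) $ a) = ?f Re + ?f Im"
    by (simp add: sum_3 matrix_vector_mult_def Sigma_inv_def vector_3 e p'_def power2_eq_square power4_eq_xxxx field_simps)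
  have "?f R \<ge> ?c * ?n R + ?d * ((R (v $ 1))\<^sup>2 - (R p')\<^sup>2)" for R
    by (rule site_energy_ge[OF assms])
  from add_mono[OF this[of Re] this[of Im]]
  have "?c * (?n Re + ?n Im) + ?d * ((Re (v $ 1))\<^sup>2 - (Re p')\<^sup>2 + ((Im (v $ 1))\<^sup>2 - (Im p')\<^sup>2)) \<le> ?f Re + ?f Im"
    by (simp only: distrib_left add_ac)
  moreover have "(Re (v $ 1))\<^sup>2 - (Re p')\<^sup>2 + ((Im (v $ 1))\<^sup>2 - (Im p')\<^sup>2) = 0"
    using p' by simp
  ultimately have le: "?c * (?n Re + ?n Im) \<le> ?f Re + ?f Im"
    by (simp only: mult_zero_right add_0_right)
  have "?c * (?n Re + ?n Im) > 0"
  proof (rule mult_pos_pos)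
    have "?n Re + ?n Im = (cmod (v $ 1))\<^sup>2 + (cmod (v $ 2))\<^sup>2 + (cmod (v $ 3))\<^sup>2"
      by (simp add: cmod_power2)
    moreover have "v $ 1 \<noteq> 0 \<or> v $ 2 \<noteq> 0 \<or> v $ 3 \<noteq> 0"
      using v by (auto simp: vec_eq_iff forall_3)
    ultimately show "?n Re + ?n Im > 0"
      by (auto simp: add_pos_nonneg add_nonneg_pos add_nonneg_eq_0_iff less_le intro!: add_nonneg_nonneg)
  qed (use assms in auto)
  then show "0 < Re (\<Sum>a\<in>UNIV. cnj (v $ a) * (Sigma_inv \<sigma> q *v v) $ a)"
    unfolding form using le by linarith
qed

section \<open>Boltzmann distributions\<close>

lemma prob_space_boltzmann:
  assumes [measurable]: "E \<in> borel_measurable M"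
    and "(\<integral>\<^sup>+x. ennreal (exp (- E x)) \<partial>M) \<noteq> 0" "(\<integral>\<^sup>+x. ennreal (exp (- E x)) \<partial>M) \<noteq> \<infinity>"
  shows "prob_space (boltzmann M E)"
proof
  show "emeasure (boltzmann M E) (space (boltzmann M E)) = 1"
    using assms(2,3) unfolding boltzmann_def
    by (simp add: emeasure_density nn_integral_divide ennreal_divide_self less_top)
qed

lemma boltzmann_distr:
  assumes X[measurable]: "X \<in> measurable M N" and [measurable]: "E \<in> borel_measurable N"
  shows "boltzmann (distr M N X) E = distr (boltzmann M (\<lambda>x. E (X x))) N X"
  unfolding boltzmann_def by (simp add: nn_integral_distr density_distr)

lemma nn_integral_boltzmann:
  assumes [measurable]: "E \<in> borel_measurable M" "f \<in> borel_measurable M"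
  shows "(\<integral>\<^sup>+x. f x \<partial>boltzmann M E) =
    (\<integral>\<^sup>+x. ennreal (exp (- E x)) * f x \<partial>M) / (\<integral>\<^sup>+x. ennreal (exp (- E x)) \<partial>M)"
proof -
  let ?Z = "\<integral>\<^sup>+x. ennreal (exp (- E x)) \<partial>M"
  have "(\<integral>\<^sup>+x. f x \<partial>boltzmann M E) = (\<integral>\<^sup>+x. ennreal (exp (- E x)) / ?Z * f x \<partial>M)"
    unfolding boltzmann_def by (rule nn_integral_density) measurable
  also have "\<dots> = (\<integral>\<^sup>+x. ennreal (exp (- E x)) * f x / ?Z \<partial>M)"
    by (intro nn_integral_cong) (simp only: divide_ennreal_def mult_ac)
  also have "\<dots> = (\<integral>\<^sup>+x. ennreal (exp (- E x)) * f x \<partial>M) / ?Z"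
    by (rule nn_integral_divide) measurable
  finally show ?thesis .
qed

text \<open>The hypothesis on \<open>T\<close> says that the image of \<open>M\<close> under \<open>T\<close> is a multiple
  of \<open>M\<close>.\<close>

lemma boltzmann_scaling:
  assumes T[measurable]: "T \<in> measurable M M" and E[measurable]: "E \<in> borel_measurable M"
    and scale: "\<And>f g. f \<in> borel_measurable M \<Longrightarrow> g \<in> borel_measurable M \<Longrightarrow>
      (\<integral>\<^sup>+x. f (T x) \<partial>M) * (\<integral>\<^sup>+x. g x \<partial>M) = (\<integral>\<^sup>+x. g (T x) \<partial>M) * (\<integral>\<^sup>+x. f x \<partial>M)"
    and Z: "(\<integral>\<^sup>+x. ennreal (exp (- E (T x))) \<partial>M) \<noteq> 0" "(\<integral>\<^sup>+x. ennreal (exp (- E (T x))) \<partial>M) \<noteq> \<infinity>"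
  shows "(\<integral>\<^sup>+x. ennreal (exp (- E x)) \<partial>M) \<noteq> 0" "(\<integral>\<^sup>+x. ennreal (exp (- E x)) \<partial>M) \<noteq> \<infinity>"
    "distr (boltzmann M (\<lambda>x. E (T x))) M T = boltzmann M E"
proof -
  let ?Z = "\<integral>\<^sup>+x. ennreal (exp (- E x)) \<partial>M" and ?Z' = "\<integral>\<^sup>+x. ennreal (exp (- E (T x))) \<partial>M"
  \<comment> \<open>Testing \<open>scale\<close> on exp (-E) and exp (-E o T) transfers
    normalisability to ?Z with the scaling factor unknown: if a product in \<open>ennreal\<close> is
    neither 0 nor infinite, neither are its factors.\<close>
  have "?Z' * ?Z' = (\<integral>\<^sup>+x. ennreal (exp (- E (T (T x)))) \<partial>M) * ?Z" (is "_ = ?a * _")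
    by (rule scale) measurable
  moreover have "?Z' * ?Z' \<noteq> 0" "?Z' * ?Z' \<noteq> \<infinity>"
    using Z by (auto simp: ennreal_mult_eq_top_iff)
  ultimately have a: "?a * ?Z \<noteq> 0" "?a * ?Z \<noteq> \<infinity>"
    by auto
  then show Z0: "?Z \<noteq> 0" and Zi: "?Z \<noteq> \<infinity>"
    by (auto simp: ennreal_mult_eq_top_iff)
  show "distr (boltzmann M (\<lambda>x. E (T x))) M T = boltzmann M E"
  proof (rule measure_eqI)
    fix A assume "A \<in> sets (distr (boltzmann M (\<lambda>x. E (T x))) M T)"
    then have A[measurable]: "A \<in> sets M" by simp
    let ?f = "\<lambda>x. ennreal (exp (- E x)) * indicator A x"
    have sB: "sets (boltzmann M E) = sets M" "sets (boltzmann M (\<lambda>x. E (T x))) = sets M" for E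
      by (simp_all add: boltzmann_def)
    have TB: "T \<in> measurable (boltzmann M (\<lambda>x. E (T x))) M"
      using T by (simp add: boltzmann_def)
    have "emeasure (distr (boltzmann M (\<lambda>x. E (T x))) M T) A =
        (\<integral>\<^sup>+x. indicator A x \<partial>distr (boltzmann M (\<lambda>x. E (T x))) M T)"
      by simp
    also have "\<dots> = (\<integral>\<^sup>+x. indicator A (T x) \<partial>boltzmann M (\<lambda>x. E (T x)))"
      by (rule nn_integral_distr[OF TB]) simp
    also have "\<dots> = (\<integral>\<^sup>+x. ?f (T x) \<partial>M) / ?Z'"
      by (rule nn_integral_boltzmann) measurable
    also have "\<dots> = (\<integral>\<^sup>+x. ?f x \<partial>M) / ?Z"
    proof -
      have "(\<integral>\<^sup>+x. ?f (T x) \<partial>M) * ?Z = ?Z' * (\<integral>\<^sup>+x. ?f x \<partial>M)"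
        by (rule scale) measurable
      then have "(\<integral>\<^sup>+x. ?f (T x) \<partial>M) * ?Z / ?Z / ?Z' = ?Z' * (\<integral>\<^sup>+x. ?f x \<partial>M) / ?Z / ?Z'"
        by simp
      moreover have "a * ?Z / ?Z = a" for a
        using Z0 Zi by (simp add: ennreal_mult_divide_eq)
      moreover have "?Z' * a / ?Z / ?Z' = a / ?Z" for a
      proof -
        have "?Z' * inverse ?Z' = 1"
          using ennreal_divide_self[of ?Z'] Z by (simp add: divide_ennreal_def less_top)
        moreover have "?Z' * a / ?Z / ?Z' = a / ?Z * (?Z' * inverse ?Z')"
          by (simp add: divide_ennreal_def mult_ac)
        ultimately show ?thesis by simp
      qed
      ultimately show ?thesis by simp
    qed
    also have "\<dots> = (\<integral>\<^sup>+x. indicator A x \<partial>boltzmann M E)"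
      by (rule nn_integral_boltzmann[symmetric]) measurable
    also have "\<dots> = emeasure (boltzmann M E) A"
      using A by (simp add: sB)
    finally show "emeasure (distr (boltzmann M (\<lambda>x. E (T x))) M T) A = emeasure (boltzmann M E) A" .
  qed (simp add: boltzmann_def)
qed

section \<open>Measurability and the partition function\<close>

lemma borel_measurable_vec_lambda:
  fixes f :: "'a \<Rightarrow> 'n::finite \<Rightarrow> 'b::euclidean_space"
  assumes "\<And>i. (\<lambda>x. f x i) \<in> borel_measurable M"
  shows "(\<lambda>x. \<chi> i. f x i) \<in> borel_measurable M"
  by (subst borel_measurable_euclidean_space)
    (auto simp: Basis_vec_def inner_axis intro!: borel_measurable_inner assms)

lemma borel_measurable_vec_component:
  fixes f :: "'a \<Rightarrow> 'b::euclidean_space ^ 'n::finite"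
  assumes "f \<in> borel_measurable M"
  shows "(\<lambda>x. f x $ i) \<in> borel_measurable M"
  by (rule borel_measurable_continuous_on[OF _ assms]) (intro continuous_intros)

lemma space_field_lebesgue: "space (field_lebesgue L) = extensional {..L}"
  by (auto simp: field_lebesgue_def space_PiM PiE_def)

lemma measurable_field_component:
  "l \<le> L \<Longrightarrow> (\<lambda>x. x l $ a) \<in> borel_measurable (field_lebesgue L)"
  unfolding field_lebesgue_def
  by (intro borel_measurable_vec_component) (auto intro: measurable_component_singleton)

lemma measurable_mode_component:
  "n \<le> L \<Longrightarrow> (\<lambda>z. z n $ a) \<in> borel_measurable (mode_space L)"
  unfolding mode_space_def
  by (intro borel_measurable_vec_component) (auto intro: measurable_component_singleton)

lemma prev_le: "l \<le> L \<Longrightarrow> prev L l \<le> L"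
  and next_layer_le: "l \<le> L \<Longrightarrow> next_layer L l \<le> L"
  by (auto simp: prev_def next_layer_def)

lemma measurable_energy: "energy \<sigma> L \<in> borel_measurable (field_lebesgue L)"
  unfolding energy_def
  by (intro borel_measurable_times borel_measurable_const borel_measurable_sum borel_measurable_add
      borel_measurable_diff borel_measurable_power measurable_field_component) (auto simp: prev_le)

lemma measurable_energy_grad:
  assumes "l \<le> L"
  shows "(\<lambda>x. energy_grad \<sigma> L x l $ a) \<in> borel_measurable (field_lebesgue L)"
proof -
  note assms [simp] prev_le[OF assms, simp] next_layer_le[OF assms, simp]
  have "\<forall>a. (\<lambda>x. energy_grad \<sigma> L x l $ a) \<in> borel_measurable (field_lebesgue L)"
    unfolding forall_3 energy_grad_def vector_3
    by (intro conjI borel_measurable_times borel_measurable_const borel_measurable_add borel_measurable_divide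
        borel_measurable_diff measurable_field_component) simp_all
  then show ?thesis by blast
qed

lemma measurable_to_modes: "to_modes L \<in> measurable (field_lebesgue L) (mode_space L)"
proof -
  have "field_dft L \<in> measurable (field_lebesgue L) (mode_space L)"
    unfolding field_dft_def mode_space_def dft_def
    by (intro measurable_restrict borel_measurable_vec_lambda borel_measurable_times borel_measurable_const
        borel_measurable_sum measurable_compose[OF _ borel_measurable_of_real] measurable_field_component) auto
  then show ?thesis
    by (simp add: to_modes_eq[abs_def])
qed

lemma measurable_modes_of_coords: "modes_of_coords L \<in> measurable (field_lebesgue L) (mode_space L)"
proof -
  have C: "(\<lambda>x. Complex (f x) (g x)) \<in> borel_measurable M"
    if "f \<in> borel_measurable M" "g \<in> borel_measurable M" for f g and M :: "'a measure"
    unfolding Complex_eq using that by measurable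
  have "(\<lambda>c. if neg_mode L n = n then complex_of_real (c n $ a)
     else if n < neg_mode L n then Complex (c n $ a) (c (neg_mode L n) $ a)
     else Complex (c (neg_mode L n) $ a) (- (c n $ a))) \<in> borel_measurable (field_lebesgue L)"
    if "n \<le> L" for n a
    using that by (cases "neg_mode L n = n"; cases "n < neg_mode L n")
      (auto intro!: C measurable_compose[OF _ borel_measurable_of_real] measurable_field_component
        neg_mode_le borel_measurable_uminus)
  then show ?thesis
    unfolding modes_of_coords_def mode_space_def
    by (intro measurable_restrict borel_measurable_vec_lambda) auto
qed

lemma measurable_mode_energy: "mode_energy \<sigma> L \<in> borel_measurable (mode_space L)"
  unfolding mode_energy_def matrix_vector_mult_def
  by (simp, intro borel_measurable_times borel_measurable_divide borel_measurable_const borel_measurable_sum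
      measurable_mode_component) (auto simp: neg_mode_le)

text \<open>The integrand is positive on a space that is not a null set, and coercivity bounds it by
  a product of Gaussians.\<close>

lemma partition_function:
  assumes "0 < \<sigma>\<^sup>2" "\<sigma>\<^sup>2 < 2"
  shows "(\<integral>\<^sup>+x. ennreal (exp (- energy \<sigma> L x)) \<partial>field_lebesgue L) \<noteq> 0"
    and "(\<integral>\<^sup>+x. ennreal (exp (- energy \<sigma> L x)) \<partial>field_lebesgue L) \<noteq> \<infinity>"
proof -
  note [measurable] = measurable_energy
  show "(\<integral>\<^sup>+x. ennreal (exp (- energy \<sigma> L x)) \<partial>field_lebesgue L) \<noteq> 0"
  proof
    assume "(\<integral>\<^sup>+x. ennreal (exp (- energy \<sigma> L x)) \<partial>field_lebesgue L) = 0"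
    then have "AE x in field_lebesgue L. \<not> True"
      by (subst (asm) nn_integral_0_iff_AE) auto
    from emeasure_eq_0_AE[OF this] show False
      using emeasure_PiM_lborel_space[of "{..L}", where 'a="real^3"] by (simp add: field_lebesgue_def)
  qed
  obtain c where c: "c > 0" "\<And>x. energy \<sigma> L x \<ge> c * (\<Sum>l\<le>L. (norm (x l))\<^sup>2)"
    using energy_coercive[OF assms] by blast
  have "(\<integral>\<^sup>+x. ennreal (exp (- energy \<sigma> L x)) \<partial>field_lebesgue L) \<le>
    (\<integral>\<^sup>+x. ennreal (exp (- c * (\<Sum>l\<le>L. (norm (x l))\<^sup>2))) \<partial>field_lebesgue L)"
    using c(2) by (intro nn_integral_mono ennreal_leI) simp
  also have "\<dots> < \<infinity>"
    unfolding field_lebesgue_def by (rule nn_integral_exp_minus_norm_finite[OF c(1)]) simp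
  finally show "(\<integral>\<^sup>+x. ennreal (exp (- energy \<sigma> L x)) \<partial>field_lebesgue L) \<noteq> \<infinity>"
    by simp
qed

section \<open>Gaussian moments\<close>

text \<open>Translating \<open>x\<close> by \<open>- t v\<close> completes the square in \<open>t \<langle>v, \<nabla>U\<rangle> - U\<close>.\<close>

lemma mgf_energy_grad:
  assumes "0 < \<sigma>\<^sup>2" "\<sigma>\<^sup>2 < 2"
  shows "(\<integral>\<^sup>+x. ennreal (exp (t * (\<Sum>l\<le>L. v l \<bullet> energy_grad \<sigma> L x l)))
      \<partial>boltzmann (field_lebesgue L) (energy \<sigma> L)) = ennreal (exp (t\<^sup>2 * energy \<sigma> L v))"
proof -
  note [measurable] = measurable_energy measurable_energy_grad
  let ?X = "\<lambda>x. \<Sum>l\<le>L. v l \<bullet> energy_grad \<sigma> L x l"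
  let ?Z = "\<integral>\<^sup>+x. ennreal (exp (- energy \<sigma> L x)) \<partial>field_lebesgue L"
  let ?y = "\<lambda>x. \<lambda>l\<in>{..L}. x l + - t *\<^sub>R v l"
  have [measurable]: "?X \<in> borel_measurable (field_lebesgue L)"
    unfolding inner_vec_def
    by (intro borel_measurable_sum borel_measurable_inner borel_measurable_const measurable_energy_grad) simp
  have e: "ennreal (exp (- energy \<sigma> L x)) * ennreal (exp (t * ?X x)) =
      ennreal (exp (t\<^sup>2 * energy \<sigma> L v)) * ennreal (exp (- energy \<sigma> L (?y x)))" for x
  proof -
    have "energy \<sigma> L (?y x) = energy \<sigma> L x + - t * ?X x + (- t)\<^sup>2 * energy \<sigma> L v"
      by (rule energy_add) simp
    then have "- energy \<sigma> L x + t * ?X x = t\<^sup>2 * energy \<sigma> L v + - energy \<sigma> L (?y x)"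
      by simp
    then show ?thesis
      by (simp only: exp_add[symmetric] ennreal_mult'[symmetric] exp_ge_zero)
  qed
  have "(\<integral>\<^sup>+x. ennreal (exp (- energy \<sigma> L (?y x))) \<partial>field_lebesgue L) = ?Z"
    unfolding field_lebesgue_def
    using nn_integral_PiM_lborel_comp[of "{..L}" "\<lambda>l x. x + - t *\<^sub>R v l" "\<lambda>x. ennreal (exp (- energy \<sigma> L x))"]
      measurable_energy[of \<sigma> L]
    by (simp only: distr_lborel_shift) (simp add: field_lebesgue_def)
  moreover have "(\<lambda>x. ennreal (exp (- energy \<sigma> L (?y x)))) \<in> borel_measurable (field_lebesgue L)"
  proof -
    have "?y \<in> measurable (field_lebesgue L) (field_lebesgue L)"
      unfolding field_lebesgue_def
      by (rule measurable_restrict) (auto intro!: borel_measurable_add measurable_component_singleton)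
    from measurable_compose[OF this measurable_energy] show ?thesis
      by measurable
  qed
  ultimately have "(\<integral>\<^sup>+x. ennreal (exp (- energy \<sigma> L x)) * ennreal (exp (t * ?X x)) \<partial>field_lebesgue L) =
      ennreal (exp (t\<^sup>2 * energy \<sigma> L v)) * ?Z"
    unfolding e by (simp add: nn_integral_cmult)
  moreover have "(\<integral>\<^sup>+x. ennreal (exp (t * ?X x)) \<partial>boltzmann (field_lebesgue L) (energy \<sigma> L)) =
    (\<integral>\<^sup>+x. ennreal (exp (- energy \<sigma> L x)) * ennreal (exp (t * ?X x)) \<partial>field_lebesgue L) / ?Z"
    by (rule nn_integral_boltzmann) measurable
  ultimately show ?thesis
    using partition_function[OF assms, of L] by (simp add: ennreal_mult_divide_eq)
qed

text \<open>The second moment of <v, grad U> is 2 U(v); polarisation gives the mixed moments. The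
  gradient of U at a unit configuration is a column of the Hessian.\<close>

lemma has_bochner_integral_energy_grad:
  assumes s: "0 < \<sigma>\<^sup>2" "\<sigma>\<^sup>2 < 2" and "l \<le> L" "k \<le> L"
  defines "B \<equiv> boltzmann (field_lebesgue L) (energy \<sigma> L)"
  shows "has_bochner_integral B (\<lambda>x. energy_grad \<sigma> L x l $ a) 0"
    and "has_bochner_integral B (\<lambda>x. energy_grad \<sigma> L x l $ a * energy_grad \<sigma> L x k $ b)
      (energy_grad \<sigma> L ((\<lambda>_. 0)(k := axis b 1)) l $ a)"
proof -
  have sets_B: "sets B = sets (field_lebesgue L)"
    by (simp add: B_def boltzmann_def)
  have B: "prob_space B"
    unfolding B_def by (rule prob_space_boltzmann[OF measurable_energy partition_function[OF s]])
  define X where "X v x = (\<Sum>l\<le>L. v l \<bullet> energy_grad \<sigma> L x l)" for v x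
  have XM: "X v \<in> borel_measurable B" for v
    unfolding X_def inner_vec_def
    by (subst measurable_cong_sets[OF sets_B refl])
      (intro borel_measurable_sum borel_measurable_inner borel_measurable_const measurable_energy_grad, simp)
  have "(\<integral>\<^sup>+x. ennreal (exp (t * X v x)) \<partial>B) = ennreal (exp (t\<^sup>2 * energy \<sigma> L v))" for t v
    unfolding B_def X_def by (rule mgf_energy_grad[OF s])
  note mom = gaussian_moments_of_mgf[OF B XM this]
  have add: "X (\<lambda>l. v l + w l) x = X v x + X w x" for v w x
    by (simp add: X_def inner_add_left sum.distrib)
  have eadd: "energy \<sigma> L (\<lambda>l. v l + w l) = energy \<sigma> L v + X w v + energy \<sigma> L w" for v w
    using energy_add[of L "\<lambda>l. v l + w l" v 1 w \<sigma>] by (simp add: X_def)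
  have prod: "has_bochner_integral B (\<lambda>x. X v x * X w x) (X w v)" for v w
  proof -
    have p: "X v x * X w x = ((X (\<lambda>l. v l + w l) x)\<^sup>2 - (X v x)\<^sup>2 - (X w x)\<^sup>2) / 2" for x
      unfolding add by (simp add: power2_eq_square algebra_simps)
    have sq: "has_bochner_integral B (\<lambda>x. (X v x)\<^sup>2) (2 * energy \<sigma> L v)" for v
      using mom(2,4)[of v] by (simp add: has_bochner_integral_iff)
    have "has_bochner_integral B (\<lambda>x. ((X (\<lambda>l. v l + w l) x)\<^sup>2 - (X v x)\<^sup>2 - (X w x)\<^sup>2) / 2)
      ((2 * energy \<sigma> L (\<lambda>l. v l + w l) - 2 * energy \<sigma> L v - 2 * energy \<sigma> L w) / 2)"
      by (intro has_bochner_integral_divide has_bochner_integral_diff sq)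
    then show ?thesis
      unfolding p eadd by simp
  qed
  have unit: "X ((\<lambda>_. 0)(l := axis a 1)) x = energy_grad \<sigma> L x l $ a" if "l \<le> L" for l a x
  proof -
    have "X ((\<lambda>_. 0)(l := axis a 1)) x = (\<Sum>k\<le>L. if k = l then energy_grad \<sigma> L x l $ a else 0)"
      unfolding X_def by (intro sum.cong refl) (simp add: inner_axis')
    then show ?thesis
      using that by simp
  qed
  show "has_bochner_integral B (\<lambda>x. energy_grad \<sigma> L x l $ a) 0"
    using mom(1,3)[of "(\<lambda>_. 0)(l := axis a 1)"] by (simp add: unit[OF \<open>l \<le> L\<close>] has_bochner_integral_iff)
  have "has_bochner_integral B (\<lambda>x. energy_grad \<sigma> L x l $ a * energy_grad \<sigma> L x k $ b)
      (X ((\<lambda>_. 0)(k := axis b 1)) ((\<lambda>_. 0)(l := axis a 1)))"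
    using prod[of "(\<lambda>_. 0)(l := axis a 1)" "(\<lambda>_. 0)(k := axis b 1)"]
    by (simp only: unit[OF \<open>l \<le> L\<close>] unit[OF \<open>k \<le> L\<close>])
  \<comment> \<open>Symmetry of the Hessian moves the unit configuration of (k, b) inside the
    gradient, where (l, a) then selects a component.\<close>
  also have "X ((\<lambda>_. 0)(k := axis b 1)) ((\<lambda>_. 0)(l := axis a 1)) = X ((\<lambda>_. 0)(l := axis a 1)) ((\<lambda>_. 0)(k := axis b 1))"
    unfolding X_def by (rule energy_grad_sym)
  finally show "has_bochner_integral B (\<lambda>x. energy_grad \<sigma> L x l $ a * energy_grad \<sigma> L x k $ b)
      (energy_grad \<sigma> L ((\<lambda>_. 0)(k := axis b 1)) l $ a)"
    by (simp only: unit[OF \<open>l \<le> L\<close>])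
qed

section \<open>Transport to the modes\<close>

text \<open>Inverse of \<open>modes_of_coords\<close> on \<open>real_modes\<close>. Composed with
  \<open>to_modes\<close> it yields an additive map of one Lebesgue space onto itself, the setting
  of the uniqueness argument for Haar measure.\<close>

definition coords_of_modes :: "nat \<Rightarrow> (nat \<Rightarrow> complex^3) \<Rightarrow> (nat \<Rightarrow> real^3)" where
  "coords_of_modes L z = (\<lambda>n\<in>{..L}. \<chi> a. if n \<le> neg_mode L n then Re (z n $ a) else - Im (z n $ a))"

lemma coords_of_modes_of_coords: "c \<in> extensional {..L} \<Longrightarrow> coords_of_modes L (modes_of_coords L c) = c"
  by (auto simp: coords_of_modes_def modes_of_coords_def fun_eq_iff vec_eq_iff extensional_def)

lemma modes_of_coords_of_modes: "z \<in> real_modes L \<Longrightarrow> modes_of_coords L (coords_of_modes L z) = z"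
  using bij_betw_imp_surj_on[OF bij_betw_modes_of_coords[of L]] coords_of_modes_of_coords
  by (metis imageE)

lemma measurable_coords_of_modes: "coords_of_modes L \<in> measurable (mode_space L) (field_lebesgue L)"
proof -
  have "(\<lambda>z. if n \<le> neg_mode L n then Re (z n $ a) else - Im (z n $ a)) \<in> borel_measurable (mode_space L)"
    if "n \<le> L" for n a
    using measurable_mode_component[OF that] by (cases "n \<le> neg_mode L n") auto
  then show ?thesis
    unfolding coords_of_modes_def field_lebesgue_def
    by (intro measurable_restrict) (auto intro!: borel_measurable_vec_lambda)
qed

lemma mode_lebesgue_eq: "mode_lebesgue L = distr (field_lebesgue L) (mode_space L) (modes_of_coords L)"
  by (simp add: mode_lebesgue_def field_lebesgue_def)

lemma field_lebesgue_coords_scaling: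
  fixes L :: nat and f g :: "(nat \<Rightarrow> real^3) \<Rightarrow> ennreal"
  defines "T \<equiv> \<lambda>x. coords_of_modes L (to_modes L x)"
  assumes "f \<in> borel_measurable (field_lebesgue L)" "g \<in> borel_measurable (field_lebesgue L)"
  shows "(\<integral>\<^sup>+x. f (T x) \<partial>field_lebesgue L) * (\<integral>\<^sup>+x. g x \<partial>field_lebesgue L) =
    (\<integral>\<^sup>+x. g (T x) \<partial>field_lebesgue L) * (\<integral>\<^sup>+x. f x \<partial>field_lebesgue L)"
  unfolding field_lebesgue_def
proof (rule nn_integral_PiM_lborel_additive; (unfold field_lebesgue_def[symmetric] space_field_lebesgue)?)
  show "T \<in> measurable (field_lebesgue L) (field_lebesgue L)"
    unfolding T_def by (rule measurable_compose[OF measurable_to_modes measurable_coords_of_modes])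
  show "T (\<lambda>i\<in>{..L}. x i + y i) = (\<lambda>i\<in>{..L}. T x i + T y i)" for x y
  proof -
    have "dft L (\<lambda>l. complex_of_real ((\<lambda>i\<in>{..L}. x i + y i) l $ a)) n =
        dft L (\<lambda>l. complex_of_real (x l $ a)) n + dft L (\<lambda>l. complex_of_real (y l $ a)) n" for n a
      unfolding dft_add[symmetric] by (rule dft_cong) simp
    then show ?thesis
      by (auto simp: T_def coords_of_modes_def to_modes_eq field_dft_def fun_eq_iff vec_eq_iff)
  qed
  show "\<exists>x\<in>extensional {..L}. T x = y" if "y \<in> extensional {..L}" for y
  proof -
    have "modes_of_coords L y \<in> real_modes L"
      using bij_betw_apply[OF bij_betw_modes_of_coords that] .
    then obtain x where "x \<in> extensional {..L}" "to_modes L x = modes_of_coords L y"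
      using bij_betw_imp_surj_on[OF bij_betw_to_modes[of L]] by (metis imageE)
    then show ?thesis
      using coords_of_modes_of_coords[OF that] by (intro bexI[of _ x]) (simp_all add: T_def)
  qed
qed (use assms in auto)

lemma energy_coords:
  "Re (mode_energy \<sigma> L (modes_of_coords L (coords_of_modes L (to_modes L x)))) = energy \<sigma> L x"
proof -
  have "fourier_modes L x (to_modes L x)"
    by (simp add: fourier_modes_iff to_modes_eq)
  from mode_energy_eq[OF this, of \<sigma>] show ?thesis
    unfolding modes_of_coords_of_modes[OF to_modes_real] by (metis Re_complex_of_real)
qed

text \<open>The distribution over modes is the image of a Boltzmann distribution of coordinates,
  which by scaling is the image of that of the fields. The composite
  \<open>modes_of_coords L (coords_of_modes L (to_modes L x))\<close> is just
  \<open>to_modes L x\<close>.\<close>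

lemma boltzmann_modes:
  assumes s: "0 < \<sigma>\<^sup>2" "\<sigma>\<^sup>2 < 2"
  shows "(\<integral>\<^sup>+z. ennreal (exp (- Re (mode_energy \<sigma> L z))) \<partial>mode_lebesgue L) \<noteq> \<infinity>"
    and "distr (boltzmann (field_lebesgue L) (energy \<sigma> L)) (mode_space L) (to_modes L) =
      boltzmann (mode_lebesgue L) (\<lambda>z. Re (mode_energy \<sigma> L z))"
proof -
  let ?M = "field_lebesgue L" and ?N = "mode_space L"
  let ?T = "\<lambda>x. coords_of_modes L (to_modes L x)"
  let ?E = "\<lambda>c. Re (mode_energy \<sigma> L (modes_of_coords L c))"
  note [measurable] = measurable_mode_energy measurable_modes_of_coords measurable_to_modes measurable_energy
  have T[measurable]: "?T \<in> measurable ?M ?M"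
    by (rule measurable_compose[OF measurable_to_modes measurable_coords_of_modes])
  have E[measurable]: "?E \<in> borel_measurable ?M"
    by measurable
  have ET: "?E (?T x) = energy \<sigma> L x" for x
    by (rule energy_coords)
  have Z: "(\<integral>\<^sup>+x. ennreal (exp (- ?E (?T x))) \<partial>?M) \<noteq> 0" "(\<integral>\<^sup>+x. ennreal (exp (- ?E (?T x))) \<partial>?M) \<noteq> \<infinity>"
    unfolding ET by (rule partition_function[OF s])+
  have fin: "(\<integral>\<^sup>+c. ennreal (exp (- ?E c)) \<partial>?M) \<noteq> \<infinity>"
    by (rule boltzmann_scaling(2)[OF T E _ Z]) (rule field_lebesgue_coords_scaling)
  have dist: "distr (boltzmann ?M (\<lambda>x. ?E (?T x))) ?M ?T = boltzmann ?M ?E"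
    by (rule boltzmann_scaling(3)[OF T E _ Z]) (rule field_lebesgue_coords_scaling)
  show "(\<integral>\<^sup>+z. ennreal (exp (- Re (mode_energy \<sigma> L z))) \<partial>mode_lebesgue L) \<noteq> \<infinity>"
    unfolding mode_lebesgue_eq using fin by (subst nn_integral_distr) auto
  have "boltzmann (mode_lebesgue L) (\<lambda>z. Re (mode_energy \<sigma> L z)) = distr (boltzmann ?M ?E) ?N (modes_of_coords L)"
    unfolding mode_lebesgue_eq by (rule boltzmann_distr) measurable
  also have "\<dots> = distr (distr (boltzmann ?M (energy \<sigma> L)) ?M ?T) ?N (modes_of_coords L)"
    unfolding dist[symmetric] ET ..
  also have "\<dots> = distr (boltzmann ?M (energy \<sigma> L)) ?N (\<lambda>x. modes_of_coords L (?T x))"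
    by (subst distr_distr) (auto simp: boltzmann_def comp_def)
  finally show "distr (boltzmann ?M (energy \<sigma> L)) ?N (to_modes L) =
      boltzmann (mode_lebesgue L) (\<lambda>z. Re (mode_energy \<sigma> L z))"
    by (simp add: modes_of_coords_of_modes[OF to_modes_real])
qed

text \<open>The covariance is the Hessian transformed in both layer indices. Transforming the first
  index of a column gives an entry of \<open>Sigma_inv\<close> times a phase in k; orthogonality of
  the phases over k then selects n = m.\<close>

lemma has_bochner_integral_Sigma_inv_modes:
  assumes s: "0 < \<sigma>\<^sup>2" "\<sigma>\<^sup>2 < 2" and n: "n \<le> L" and m: "m \<le> L"
  defines "B \<equiv> boltzmann (field_lebesgue L) (energy \<sigma> L)"
    and "Y \<equiv> \<lambda>n x. Sigma_inv \<sigma> (wavevector L n) *v to_modes L x n"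
  shows "has_bochner_integral B (\<lambda>x. Y n x $ a) 0"
    and "has_bochner_integral B (\<lambda>x. Y n x $ a * cnj (Y m x $ b))
      (if n = m then Sigma_inv \<sigma> (wavevector L n) $ a $ b else 0)"
proof -
  let ?c = "complex_of_real (1 / sqrt (real (L + 1)))"
  let ?G = "\<lambda>x l a. energy_grad \<sigma> L x l $ a"
  let ?A = "Sigma_inv \<sigma> (wavevector L n)"
  define u :: "nat \<Rightarrow> nat \<Rightarrow> real^3" where "u k = (\<lambda>_. 0)(k := axis b 1)" for k
  have Y: "Y n x $ a = (\<Sum>l\<le>L. ?c * phase L n l * complex_of_real (?G x l a))" if "n \<le> L" for n a x
    using that by (simp add: Y_def to_modes_eq Sigma_inv_mult_dft dft_def sum_distrib_left mult.assoc)
  have "has_bochner_integral B (\<lambda>x. \<Sum>l\<le>L. ?c * phase L n l * complex_of_real (?G x l a))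
      (\<Sum>l\<le>L. ?c * phase L n l * complex_of_real 0)"
    unfolding B_def
    by (intro has_bochner_integral_sum has_bochner_integral_mult_right
        has_bochner_integral_bounded_linear[OF bounded_linear_of_real] has_bochner_integral_energy_grad[OF s]) auto
  then show "has_bochner_integral B (\<lambda>x. Y n x $ a) 0"
    unfolding Y[OF n] by simp
  have YY: "Y n x $ a * cnj (Y m x $ b) =
    (\<Sum>l\<le>L. \<Sum>k\<le>L. (?c * phase L n l) * (?c * cnj (phase L m k)) * complex_of_real (?G x l a * ?G x k b))" for x
    unfolding Y[OF n] Y[OF m] cnj_sum sum_product by (intro sum.cong refl) simp
  have "has_bochner_integral B
     (\<lambda>x. \<Sum>l\<le>L. \<Sum>k\<le>L. (?c * phase L n l) * (?c * cnj (phase L m k)) * complex_of_real (?G x l a * ?G x k b))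
     (\<Sum>l\<le>L. \<Sum>k\<le>L. (?c * phase L n l) * (?c * cnj (phase L m k)) * complex_of_real (?G (u k) l a))"
    unfolding B_def u_def
    by (intro has_bochner_integral_sum has_bochner_integral_mult_right
        has_bochner_integral_bounded_linear[OF bounded_linear_of_real] has_bochner_integral_energy_grad[OF s]) auto
  moreover have "(\<Sum>l\<le>L. \<Sum>k\<le>L. (?c * phase L n l) * (?c * cnj (phase L m k)) * complex_of_real (?G (u k) l a)) =
    (if n = m then ?A $ a $ b else 0)"
  proof -
    have "(\<Sum>l\<le>L. \<Sum>k\<le>L. (?c * phase L n l) * (?c * cnj (phase L m k)) * complex_of_real (?G (u k) l a)) =
      (\<Sum>k\<le>L. ?c * cnj (phase L m k) * dft L (\<lambda>l. complex_of_real (?G (u k) l a)) n)"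
      by (subst sum.swap) (simp add: dft_def sum_distrib_left mult_ac)
    also have "\<dots> = (\<Sum>k\<le>L. ?c * cnj (phase L m k) * (?A $ a $ b * (?c * phase L n k)))"
    proof (intro sum.cong refl arg_cong2[where f = "(*)"])
      fix k assume k: "k \<in> {..L}"
      \<comment> \<open>A field supported on one layer and component transforms into a pure
        phase.\<close>
      have "field_dft L (u k) n $ d = (if d = b then ?c * phase L n k else 0)" for d
      proof -
        have "(\<Sum>l\<le>L. phase L n l * complex_of_real (u k l $ d)) =
            (\<Sum>l\<le>L. if l = k then phase L n l * complex_of_real (axis b 1 $ d) else 0)"
          by (intro sum.cong refl) (simp add: u_def)
        then show ?thesis
          using n k by (simp add: field_dft_def dft_def axis_def)
      qed
      then have "(?A *v field_dft L (u k) n) $ a = ?A $ a $ b * (?c * phase L n k)"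
        by (simp add: matrix_vector_mult_def if_distrib[of "\<lambda>c. _ * c"] cong: if_cong)
      then show "dft L (\<lambda>l. complex_of_real (?G (u k) l a)) n = ?A $ a $ b * (?c * phase L n k)"
        by (simp only: Sigma_inv_mult_dft[OF n])
    qed
    also have "\<dots> = ?A $ a $ b * (?c * ?c * (\<Sum>k\<le>L. phase L n k * cnj (phase L m k)))"
      by (simp only: sum_distrib_left mult_ac)
    also have "\<dots> = (if n = m then ?A $ a $ b else 0)"
      unfolding phase_orthogonal[OF n m] using inverse_sqrt_square[of L] 
      by (cases "n = m") (simp_all only: simp_thms if_True if_False mult_1_right mult_zero_right)
    finally show ?thesis .
  qed
  ultimately show "has_bochner_integral B (\<lambda>x. Y n x $ a * cnj (Y m x $ b))
      (if n = m then ?A $ a $ b else 0)"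
    unfolding YY by simp
qed

section \<open>Inverting the mode matrices\<close>

lemma pos_def_hermitian_imp_invertible:
  fixes A :: "complex^'n^'n"
  assumes "pos_def_hermitian A"
  shows "invertible A"
  unfolding invertible_left_inverse matrix_left_invertible_ker
proof (intro allI impI)
  fix v assume "A *v v = 0"
  then have "Re (\<Sum>a\<in>UNIV. cnj (v $ a) * (A *v v) $ a) = 0"
    by simp
  then show "v = 0"
    using assms unfolding pos_def_hermitian_def by (metis less_irrefl)
qed

lemma matrix_inv_mult:
  fixes A :: "'a::semiring_1^'n^'m"
  assumes "invertible A"
  shows "A ** matrix_inv A = mat 1" "matrix_inv A ** A = mat 1"
  using someI_ex[OF assms[unfolded invertible_def]] by (auto simp: matrix_inv_def)

lemma matrix_inv_matrix_inv:
  fixes A :: "'a::semiring_1^'n^'m"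
  assumes "invertible A"
  shows "invertible (matrix_inv A)" "matrix_inv (matrix_inv A) = A"
proof -
  show inv: "invertible (matrix_inv A)"
    using matrix_inv_mult[OF assms] unfolding invertible_def by blast
  have "matrix_inv (matrix_inv A) = (A ** matrix_inv A) ** matrix_inv (matrix_inv A)"
    by (simp add: matrix_inv_mult(1)[OF assms])
  also have "\<dots> = A"
    by (simp add: matrix_inv_mult(1)[OF inv] flip: matrix_mul_assoc)
  finally show "matrix_inv (matrix_inv A) = A" .
qed

lemma has_bochner_integral_modes:
  assumes s: "0 < \<sigma>\<^sup>2" "\<sigma>\<^sup>2 < 2" and n: "n \<le> L" and m: "m \<le> L"
  defines "B \<equiv> boltzmann (field_lebesgue L) (energy \<sigma> L)"
  shows "has_bochner_integral B (\<lambda>x. to_modes L x n $ a) 0"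
    and "has_bochner_integral B (\<lambda>x. to_modes L x n $ a * cnj (to_modes L x m $ b))
      (if n = m then matrix_inv (Sigma_inv \<sigma> (wavevector L n)) $ a $ b else 0)"
proof -
  let ?A = "\<lambda>n. Sigma_inv \<sigma> (wavevector L n)"
  let ?V = "\<lambda>n. matrix_inv (?A n)"
  let ?Y = "\<lambda>n x. ?A n *v to_modes L x n"
  have inv: "invertible (?A n)" for n
    by (rule pos_def_hermitian_imp_invertible[OF pos_def_hermitian_Sigma_inv[OF s]])
  have V: "?V n ** ?A n = mat 1" "?A n ** ?V n = mat 1" for n
    using matrix_inv_mult[OF inv] by auto
  have z: "to_modes L x n $ a = (\<Sum>c\<in>UNIV. ?V n $ a $ c * ?Y n x $ c)" for x n a
  proof -
    have "(?V n *v ?Y n x) $ a = (\<Sum>c\<in>UNIV. ?V n $ a $ c * ?Y n x $ c)"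
      by (subst matrix_vector_mult_def) simp
    then show ?thesis
      by (simp add: matrix_vector_mul_assoc V)
  qed
  have "has_bochner_integral B (\<lambda>x. \<Sum>c\<in>UNIV. ?V n $ a $ c * ?Y n x $ c) (\<Sum>c\<in>UNIV. ?V n $ a $ c * 0)"
    unfolding B_def
    by (intro has_bochner_integral_sum has_bochner_integral_mult_right has_bochner_integral_Sigma_inv_modes[OF s n m])
  then show "has_bochner_integral B (\<lambda>x. to_modes L x n $ a) 0"
    unfolding z[symmetric] by simp
  have zz: "to_modes L x n $ a * cnj (to_modes L x m $ b) =
      (\<Sum>c\<in>UNIV. \<Sum>d\<in>UNIV. ?V n $ a $ c * cnj (?V m $ b $ d) * (?Y n x $ c * cnj (?Y m x $ d)))" for x
    unfolding z[of x n a] z[of x m b] cnj_sum sum_product by (intro sum.cong refl) simp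
  have "has_bochner_integral B (\<lambda>x. to_modes L x n $ a * cnj (to_modes L x m $ b))
      (\<Sum>c\<in>UNIV. \<Sum>d\<in>UNIV. ?V n $ a $ c * cnj (?V m $ b $ d) * (if n = m then ?A n $ c $ d else 0))"
    unfolding B_def zz
    by (intro has_bochner_integral_sum has_bochner_integral_mult_right has_bochner_integral_Sigma_inv_modes[OF s n m])
  \<comment> \<open>This is V A V^H = V: as A is Hermitian, A V^H is the conjugate transpose of V A
    = 1.\<close>
  moreover have "(\<Sum>c\<in>UNIV. \<Sum>d\<in>UNIV. ?V n $ a $ c * cnj (?V n $ b $ d) * ?A n $ c $ d) = ?V n $ a $ b"
  proof -
    have h: "?A n $ c $ d = cnj (?A n $ d $ c)" for c d
      using pos_def_hermitian_Sigma_inv[OF s, of "wavevector L n"] unfolding pos_def_hermitian_def by blast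
    have "(\<Sum>d\<in>UNIV. cnj (?V n $ b $ d) * ?A n $ c $ d) = cnj ((?V n ** ?A n) $ b $ c)" for c
      unfolding matrix_matrix_mult_def by (subst h) simp
    then have d: "(\<Sum>d\<in>UNIV. cnj (?V n $ b $ d) * ?A n $ c $ d) = (if b = c then 1 else 0)" for c
      by (simp add: V mat_def)
    have "(\<Sum>c\<in>UNIV. \<Sum>d\<in>UNIV. ?V n $ a $ c * cnj (?V n $ b $ d) * ?A n $ c $ d) =
        (\<Sum>c\<in>UNIV. ?V n $ a $ c * (\<Sum>d\<in>UNIV. cnj (?V n $ b $ d) * ?A n $ c $ d))"
      by (simp add: sum_distrib_left mult.assoc)
    also have "\<dots> = ?V n $ a $ b"
      unfolding d by (simp add: if_distrib[of "\<lambda>c. _ * c"] cong: if_cong)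
    finally show ?thesis .
  qed
  ultimately show "has_bochner_integral B (\<lambda>x. to_modes L x n $ a * cnj (to_modes L x m $ b))
      (if n = m then ?V n $ a $ b else 0)"
    by (cases "n = m") simp_all
qed

theorem mainTheorem8:
  fixes \<sigma> :: real and L :: nat
  assumes "0 < \<sigma>\<^sup>2" and "\<sigma>\<^sup>2 < 2"
  defines "P \<equiv> boltzmann (mode_lebesgue L) (\<lambda>z. Re (mode_energy \<sigma> L z))"
  shows
    \<comment> \<open>the change of variables\<close>
    "(\<forall>x. \<exists>!z. z \<in> extensional {..L} \<and> fourier_modes L x z) \<and>
     bij_betw (to_modes L) (extensional {..L}) (real_modes L) \<and>
     (\<forall>x z. fourier_modes L x z \<longrightarrow> complex_of_real (energy \<sigma> L x) = mode_energy \<sigma> L z) \<and>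
     \<comment> \<open>the distribution over Fourier modes\<close>
     integrable (field_lebesgue L) (\<lambda>x. exp (- energy \<sigma> L x)) \<and>
     prob_space (boltzmann (field_lebesgue L) (energy \<sigma> L)) \<and>
     distr (boltzmann (field_lebesgue L) (energy \<sigma> L)) (mode_space L) (to_modes L) = P \<and>
     \<comment> \<open>it is well defined as a Gaussian with the given inverse covariance matrix\<close>
     (\<forall>n\<le>L. pos_def_hermitian (Sigma_inv \<sigma> (wavevector L n))) \<and>
     integrable (mode_lebesgue L) (\<lambda>z. exp (- Re (mode_energy \<sigma> L z))) \<and>
     prob_space P \<and>
     (\<forall>n\<le>L. \<forall>a. integrable P (\<lambda>z. z n $ a)) \<and>
     (\<forall>n\<le>L. \<forall>m\<le>L. \<forall>a b. integrable P (\<lambda>z. z n $ a * cnj (z m $ b))) \<and>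
     (\<forall>n\<le>L. mode_mean P n = 0) \<and>
     (\<forall>n\<le>L. invertible (mode_cov P n n) \<and>
        matrix_inv (mode_cov P n n) = Sigma_inv \<sigma> (wavevector L n)) \<and>
     (\<forall>n\<le>L. \<forall>m\<le>L. n \<noteq> m \<longrightarrow> mode_cov P n m = 0)"
proof -
  note s = assms(1,2)
  let ?B = "boltzmann (field_lebesgue L) (energy \<sigma> L)"
  let ?A = "\<lambda>n. Sigma_inv \<sigma> (wavevector L n)"
  note [measurable] = measurable_energy measurable_mode_energy
  have P: "distr ?B (mode_space L) (to_modes L) = P"
    unfolding P_def by (rule boltzmann_modes(2)[OF s])
  have B: "prob_space ?B"
    by (rule prob_space_boltzmann[OF measurable_energy partition_function[OF s]])
  have tm: "to_modes L \<in> measurable ?B (mode_space L)"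
    using measurable_to_modes by (simp add: boltzmann_def)
  have prob: "prob_space P"
    unfolding P[symmetric] by (rule prob_space.prob_space_distr[OF B tm])
  \<comment> \<open>All moments were computed under the distribution of the fields; they pass to P
    as to an image measure.\<close>
  have hb: "has_bochner_integral P f I"
    if "has_bochner_integral ?B (\<lambda>x. f (to_modes L x)) I" "f \<in> borel_measurable (mode_space L)"
    for f :: "_ \<Rightarrow> complex" and I
    unfolding P[symmetric] using that
    by (simp add: has_bochner_integral_iff integrable_distr_eq[OF tm] integral_distr[OF tm])
  have mean: "has_bochner_integral P (\<lambda>z. z n $ a) 0" if "n \<le> L" for n a
    using that by (intro hb has_bochner_integral_modes[OF s] measurable_mode_component) auto
  have "(\<lambda>z. z n $ a * cnj (z m $ b)) \<in> borel_measurable (mode_space L)" if "n \<le> L" "m \<le> L" for n m a b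
  proof (intro borel_measurable_times measurable_mode_component that)
    have "cnj \<in> borel_measurable borel"
      by (intro borel_measurable_continuous_onI continuous_intros)
    from measurable_compose[OF measurable_mode_component[OF that(2)] this]
    show "(\<lambda>z. cnj (z m $ b)) \<in> borel_measurable (mode_space L)" .
  qed
  then have cov: "has_bochner_integral P (\<lambda>z. z n $ a * cnj (z m $ b))
      (if n = m then matrix_inv (?A n) $ a $ b else 0)" if "n \<le> L" "m \<le> L" for n m a b
    using that by (intro hb has_bochner_integral_modes[OF s]) auto
  have mean0: "mode_mean P n = 0" if "n \<le> L" for n
    using mean[OF that] by (simp add: mode_mean_def vec_eq_iff has_bochner_integral_iff)
  have cov': "mode_cov P n m = (if n = m then matrix_inv (?A n) else 0)" if "n \<le> L" "m \<le> L" for n m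
    using cov[OF that] by (simp add: mode_cov_def mean0 that vec_eq_iff has_bochner_integral_iff)
  have "invertible (matrix_inv (?A n)) \<and> matrix_inv (matrix_inv (?A n)) = ?A n" for n
    using matrix_inv_matrix_inv[OF pos_def_hermitian_imp_invertible[OF pos_def_hermitian_Sigma_inv[OF s]]]
    by blast
  then have inverse_cov: "\<forall>n\<le>L. invertible (mode_cov P n n) \<and> matrix_inv (mode_cov P n n) = ?A n"
    by (simp add: cov')
  have integrable_field: "integrable (field_lebesgue L) (\<lambda>x. exp (- energy \<sigma> L x))"
    using partition_function(2)[OF s, of L] by (intro integrableI_nonneg) (auto simp: less_top)
  have integrable_mode: "integrable (mode_lebesgue L) (\<lambda>z. exp (- Re (mode_energy \<sigma> L z)))"
  proof (rule integrableI_nonneg)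
    show "(\<lambda>z. exp (- Re (mode_energy \<sigma> L z))) \<in> borel_measurable (mode_lebesgue L)"
      by (simp add: mode_lebesgue_def)
  qed (use boltzmann_modes(1)[OF s, of L] in \<open>auto simp: less_top\<close>)
  have integrable_component: "\<forall>n\<le>L. \<forall>a. integrable P (\<lambda>z. z n $ a)"
    using mean by (auto simp: has_bochner_integral_iff)
  have integrable_product: "\<forall>n\<le>L. \<forall>m\<le>L. \<forall>a b. integrable P (\<lambda>z. z n $ a * cnj (z m $ b))"
    using cov unfolding has_bochner_integral_iff by blast
  have zero: "\<forall>n\<le>L. mode_mean P n = 0" "\<forall>n\<le>L. \<forall>m\<le>L. n \<noteq> m \<longrightarrow> mode_cov P n m = 0"
    using mean0 cov' by auto
  show ?thesis
    by (intro conjI inverse_cov integrable_field integrable_mode integrable_component integrable_product zero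
        allI[OF ex1_fourier_modes] bij_betw_to_modes B P prob)
      (simp_all add: mode_energy_eq pos_def_hermitian_Sigma_inv[OF s])
qed

end
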